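(* Consider the setting described in the context, assume A1–A5, and let $s=\frac{r}{2-4r}$. A sequence of alternatives $f_n$ with $cn^{-r}\le\|f_n\|\le Cn^{-r}$ (constants $0<c<C$) is consistent if and only if there exist $P_0>0$, constants $0<c_1\le C_1$ and a sequence $f_{1n}\in\bar{\mathbb{B}}^s_{2\infty}(P_0)$ with $c_1n^{-r}\le\|f_{1n}\|\le C_1n^{-r}$ such that $$\|f_n\|^2=\|f_{1n}\|^2+\|f_n-f_{1n}\|^2 .$$
   Context: Fix $\sigma>0$, $0<r<1/2$ and an orthonormal basis $(\phi_j)_{j\ge1}$ of $\mathbb{L}_2(0,1)$. For each $n$ one observes $dY_n(t)=f(t)\,dt+\sigma n^{-1/2}dw(t)$, equivalently $y_j=\theta_j+\sigma n^{-1/2}\xi_j$, $\theta_j=\int_0^1f\phi_j$, $\xi_j$ i.i.d. $N(0,1)$; $H_0:f=0$. Weights $\kappa_{nj}^2\ge0$, $\rho_n=\sum_j\kappa_{nj}^2$, $T_n(Y_n)=\sum_j\kappa_{nj}^2y_j^2-\sigma^2n^{-1}\rho_n$, $k_n=\sup\{k:\sum_{j<k}\kappa_{nj}^2\le\rho_n/2\}$, $\kappa_n^2=\kappa_{nk_n}^2$. Assumptions: (A1) $j\mapsto\kappa_{nj}^2$ decreasing; (A2) $C_1<\sigma^{-4}n^2\sum_j\kappa_{nj}^4<C_2$; (A3) $c_1n^{-2r}\le\rho_n\le c_2n^{-2r}$; (A4) $\exists C_1>0,\lambda>1$: $\kappa^2_{n,[(1+\delta)k_n]}<C_1(1+\delta)^{-\lambda}\kappa_n^2$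 for all $\delta>0,n$; (A5) $\kappa_{n1}^2\asymp\kappa_n^2$ and for each $c>1$ there is $C>0$ with $\kappa^2_{n,[ck_n]}\ge C\kappa_n^2$. A test generated by $T_n$ rejects $H_0$ iff $T_n$ exceeds a threshold. A sequence $f_n$ is consistent if for every $\alpha\in(0,1)$ and every sequence of tests $K_n$ generated by $T_n$ with $\alpha(K_n)=\alpha(1+o(1))$, $\limsup_n\beta(K_n,f_n)<1-\alpha$ ($\alpha(\cdot)$, $\beta(\cdot,f)$: type I and type II error probabilities). $\bar{\mathbb{B}}^s_{2\infty}(P_0)=\{f=\sum_j\theta_j\phi_j:\ \sup_{\lambda>0}\lambda^{2s}\sum_{j>\lambda}\theta_j^2\le P_0\}$. *)

theory Defs
  imports "HOL-Probability.Probability"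
begin

text \<open>Sequence-space model. A signal f in L2(0,1) is identified with its coefficient
  sequence theta j (j >= 1) w.r.t. the fixed orthonormal basis; index 0 is unused.
  Weights w n j stand for kappa_{nj}^2.\<close>

definition l2sq :: "(nat \<Rightarrow> real) \<Rightarrow> real" where
  "l2sq \<theta> = (\<Sum>j. (\<theta> (Suc j))\<^sup>2)"

definition l2norm :: "(nat \<Rightarrow> real) \<Rightarrow> real" where
  "l2norm \<theta> = sqrt (l2sq \<theta>)"

definition in_L2 :: "(nat \<Rightarrow> real) \<Rightarrow> bool" where
  "in_L2 \<theta> \<longleftrightarrow> summable (\<lambda>j. (\<theta> (Suc j))\<^sup>2)"

definition besov_ball :: "real \<Rightarrow> real \<Rightarrow> (nat \<Rightarrow> real) set" where
  "besov_ball s P0 = {\<theta>. in_L2 \<theta> \<and>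
     (\<forall>lam>0. lam powr (2 * s) * suminf (\<lambda>j. if real (Suc j) > lam then (\<theta> (Suc j))\<^sup>2 else 0) \<le> P0)}"

definition rho :: "(nat \<Rightarrow> nat \<Rightarrow> real) \<Rightarrow> nat \<Rightarrow> real" where
  "rho w n = (\<Sum>j. w n (Suc j))"

definition kn :: "(nat \<Rightarrow> nat \<Rightarrow> real) \<Rightarrow> nat \<Rightarrow> nat" where
  "kn w n = Sup {k. (\<Sum>j\<in>{1..<k}. w n j) \<le> rho w n / 2}"

definition kappa2 :: "(nat \<Rightarrow> nat \<Rightarrow> real) \<Rightarrow> nat \<Rightarrow> real" where
  "kappa2 w n = w n (kn w n)"

definition noise :: "(nat \<Rightarrow> real) measure" where
  "noise = (\<Pi>\<^sub>M j\<in>UNIV. density lborel std_normal_density)"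

text \<open>Test statistic T_n evaluated on the observation y_j = theta_j + sigma n^(-1/2) xi_j.\<close>
definition Tstat :: "real \<Rightarrow> (nat \<Rightarrow> nat \<Rightarrow> real) \<Rightarrow> nat \<Rightarrow> (nat \<Rightarrow> real) \<Rightarrow> (nat \<Rightarrow> real) \<Rightarrow> real" where
  "Tstat \<sigma> w n \<theta> \<omega> =
     (\<Sum>j. w n (Suc j) * (\<theta> (Suc j) + \<sigma> / sqrt (real n) * \<omega> (Suc j))\<^sup>2)
     - \<sigma>\<^sup>2 / real n * rho w n"

definition type1 :: "real \<Rightarrow> (nat \<Rightarrow> nat \<Rightarrow> real) \<Rightarrow> nat \<Rightarrow> real \<Rightarrow> real" where
  "type1 \<sigma> w n t = measure noise {\<omega> \<in> space noise. Tstat \<sigma> w n (\<lambda>_. 0) \<omega> > t}"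

definition type2 :: "real \<Rightarrow> (nat \<Rightarrow> nat \<Rightarrow> real) \<Rightarrow> nat \<Rightarrow> real \<Rightarrow> (nat \<Rightarrow> real) \<Rightarrow> real" where
  "type2 \<sigma> w n t \<theta> = measure noise {\<omega> \<in> space noise. Tstat \<sigma> w n \<theta> \<omega> \<le> t}"

definition consistent :: "real \<Rightarrow> (nat \<Rightarrow> nat \<Rightarrow> real) \<Rightarrow> (nat \<Rightarrow> nat \<Rightarrow> real) \<Rightarrow> bool" where
  "consistent \<sigma> w f \<longleftrightarrow>
     (\<forall>\<alpha>::real. 0 < \<alpha> \<and> \<alpha> < 1 \<longrightarrow>
       (\<forall>t :: nat \<Rightarrow> real. ((\<lambda>n. type1 \<sigma> w n (t n) / \<alpha>) \<longlonglongrightarrow> 1) \<longrightarrow>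
          limsup (\<lambda>n. ereal (type2 \<sigma> w n (t n) (f n))) < ereal (1 - \<alpha>)))"

definition A1 :: "(nat \<Rightarrow> nat \<Rightarrow> real) \<Rightarrow> bool" where
  "A1 w \<longleftrightarrow> (\<forall>n\<ge>1. \<forall>i j. 1 \<le> i \<and> i \<le> j \<longrightarrow> w n j \<le> w n i)"

definition A2 :: "real \<Rightarrow> (nat \<Rightarrow> nat \<Rightarrow> real) \<Rightarrow> bool" where
  "A2 \<sigma> w \<longleftrightarrow> (\<exists>C1 C2. 0 < C1 \<and> (\<forall>n\<ge>1. summable (\<lambda>j. (w n (Suc j))\<^sup>2) \<and>
      C1 < (real n)\<^sup>2 / \<sigma>^4 * (\<Sum>j. (w n (Suc j))\<^sup>2) \<and>
      (real n)\<^sup>2 / \<sigma>^4 * (\<Sum>j. (w n (Suc j))\<^sup>2) < C2))"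

definition A3 :: "real \<Rightarrow> (nat \<Rightarrow> nat \<Rightarrow> real) \<Rightarrow> bool" where
  "A3 r w \<longleftrightarrow> (\<exists>c1 c2. 0 < c1 \<and> (\<forall>n\<ge>1. summable (\<lambda>j. w n (Suc j)) \<and>
      c1 * real n powr (-2*r) \<le> rho w n \<and> rho w n \<le> c2 * real n powr (-2*r)))"

definition A4 :: "(nat \<Rightarrow> nat \<Rightarrow> real) \<Rightarrow> bool" where
  "A4 w \<longleftrightarrow> (\<exists>C1 lam. C1 > 0 \<and> lam > 1 \<and> (\<forall>\<delta>>0. \<forall>n\<ge>1.
      w n (nat \<lfloor>(1+\<delta>) * real (kn w n)\<rfloor>) < C1 * (1+\<delta>) powr (-lam) * kappa2 w n))"

definition A5 :: "(nat \<Rightarrow> nat \<Rightarrow> real) \<Rightarrow> bool" where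
  "A5 w \<longleftrightarrow> (\<exists>c C. 0 < c \<and> (\<forall>n\<ge>1. c * kappa2 w n \<le> w n 1 \<and> w n 1 \<le> C * kappa2 w n)) \<and>
     (\<forall>c>1. \<exists>C>0. \<forall>n\<ge>1. w n (nat \<lfloor>c * real (kn w n)\<rfloor>) \<ge> C * kappa2 w n)"

end

theory Submission
  imports Defs
begin

text \<open>
  After centring by \<open>\<Sum>j. \<kappa>\<^sub>n\<^sub>j\<^sup>2 \<theta>\<^sub>j\<^sup>2\<close> and division by its null standard deviation, which is of order
  \<open>1/n\<^sup>2\<close>, the statistic is asymptotically standard normal both under the null and under \<open>f\<^sub>n\<close>: the largest
  weight is negligible against the Hilbert-Schmidt norm of the weights, and the cross terms
  \<open>\<theta>\<^sub>j \<xi>\<^sub>j\<close> are negligible because \<open>r < 1/2\<close>. Characteristic functions of the partial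
  sums and Levy continuity give this. Hence \<open>f\<^sub>n\<close> is consistent iff
  \<open>n\<^sup>2 \<Sum>j. \<kappa>\<^sub>n\<^sub>j\<^sup>2 \<theta>\<^sub>j\<^sup>2\<close> is eventually bounded away from zero.

  The assumptions force \<open>\<kappa>\<^sub>n\<^sup>2\<close> to be of order \<open>n\<close> to the power \<open>2r - 2\<close> and \<open>k\<^sub>n\<close> to be of order \<open>n\<close> to the
  power \<open>2 - 4r\<close>, so the last condition says that a fixed proportion of the energy of \<open>f\<^sub>n\<close> sits in the first
  \<open>c k\<^sub>n\<close> coefficients for some constant \<open>c\<close>. Truncating there gives the required \<open>f\<^sub>1\<^sub>n\<close>, and conversely an
  orthogonal Besov component has little energy beyond \<open>c k\<^sub>n\<close> and therefore forces energy of \<open>f\<^sub>n\<close> below it.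
\<close>

section \<open>Gaussian moments and the characteristic function of one quadratic summand\<close>

definition gauss_const :: real where
  "gauss_const = (LINT x|std_normal_distribution. (x\<^sup>2 + 1) ^ 3)"

text \<open>The moments of orders 1 to 4 are 0, 1, 0, 3. Packed into one polynomial formula, they
  give the mean and the variance of a quadratic summand by comparing coefficients.\<close>

lemma has_bochner_integral_std_normal_quartic:
  fixes p0 p1 p2 p3 p4 :: real
  shows "has_bochner_integral std_normal_distribution
    (\<lambda>x. p4 * x ^ 4 + p3 * x ^ 3 + p2 * x\<^sup>2 + p1 * x + p0) (3 * p4 + p2 + p0)"
proof -
  interpret N: real_distribution std_normal_distribution by (rule real_dist_normal_dist)
  have m: "has_bochner_integral std_normal_distribution (\<lambda>x. x ^ 4) 3"
    "has_bochner_integral std_normal_distribution (\<lambda>x. x ^ 3) 0"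
    "has_bochner_integral std_normal_distribution (\<lambda>x. x ^ 2) 1"
    "has_bochner_integral std_normal_distribution (\<lambda>x. x ^ 1) 0"
    using integrable_std_normal_distribution_moment[of 1]
      integral_std_normal_distribution_moment_odd[of 1] integral_std_normal_distribution_moment_odd[of 3]
      std_normal_distribution_even_moments(1)[of 1] std_normal_distribution_even_moments(1)[of 2]
    by (auto simp: has_bochner_integral_iff integrable_std_normal_distribution_moment fact_numeral
        simp del: power_one_right)
  have "has_bochner_integral std_normal_distribution (\<lambda>x. p0) p0"
    using N.prob_space by (simp add: has_bochner_integral_iff)
  then have "has_bochner_integral std_normal_distribution
    (\<lambda>x. p4 * x ^ 4 + p3 * x ^ 3 + p2 * x\<^sup>2 + p1 * x ^ 1 + p0) (p4 * 3 + p3 * 0 + p2 * 1 + p1 * 0 + p0)"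
    by (intro has_bochner_integral_add has_bochner_integral_mult_right m)
  then show ?thesis by (simp add: mult.commute)
qed

lemma std_normal_integrable_const: "integrable std_normal_distribution (\<lambda>x. a::real)"
  using prob_space_normal_density[of 1 0]
  by (simp add: finite_measure.integrable_const prob_space.finite_measure)

lemma integrable_gauss_const: "integrable std_normal_distribution (\<lambda>x::real. (x\<^sup>2 + 1) ^ 3)"
proof -
  have "(\<lambda>x::real. (x\<^sup>2 + 1) ^ 3) = (\<lambda>x. x ^ 6 + 3 * x ^ 4 + 3 * x ^ 2 + 1)"
    by (auto simp: fun_eq_iff) algebra
  then show ?thesis
    by (simp only:) (intro Bochner_Integration.integrable_add integrable_mult_right integrable_std_normal_distribution_moment
        std_normal_integrable_const)
qed

lemma gauss_const_nonneg: "0 \<le> gauss_const"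
  unfolding gauss_const_def by (intro integral_nonneg_AE) auto

lemma cube_add_le:
  fixes u v :: real
  assumes "0 \<le> u" "0 \<le> v"
  shows "(u + v) ^ 3 \<le> 4 * (u ^ 3 + v ^ 3)"
proof -
  have "4 * (u ^ 3 + v ^ 3) - (u + v) ^ 3 = 3 * (u + v) * (u - v)\<^sup>2"
    by algebra
  also have "\<dots> \<ge> 0" using assms by simp
  finally show ?thesis by simp
qed

text \<open>Sandwich: \<open>1 - y\<close> lies below \<open>exp (- y)\<close>, which lies below
  \<open>1 / (1 + y)\<close> and hence below \<open>1 - y + y\<^sup>2\<close>. It is what allows a
  second-order Taylor polynomial to be replaced by a Gaussian factor that multiplies well.\<close>

lemma exp_minus_linear_bound:
  fixes y :: real
  assumes "0 \<le> y"
  shows "\<bar>1 - y - exp (- y)\<bar> \<le> y\<^sup>2"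
proof -
  have "exp (- y) \<le> 1 / (1 + y)"
    using assms exp_ge_add_one_self[of y] by (simp add: exp_minus field_simps)
  also have "\<dots> \<le> 1 - y + y\<^sup>2"
    using assms by (simp add: field_simps power2_eq_square)
  finally show ?thesis using exp_ge_add_one_self[of "-y"] by simp
qed

text \<open>The summand has mean 0 and variance 2 b^2 + c^2. A second-order expansion leaves a
  third-moment remainder, and exponentiating 1 - t^2 b^2 costs t^4 b^4. Only the quadratic part of
  the variance enters the Gaussian target: the share c^2 of the linear term is booked as an error,
  because it vanishes in the limit.\<close>

lemma char_quadratic_gaussian:
  fixes b c t :: real
  shows "cmod (char (distr std_normal_distribution borel (\<lambda>x. b * (x\<^sup>2 - 1) + c * x)) t
           - complex_of_real (exp (- (t\<^sup>2 * b\<^sup>2))))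
    \<le> gauss_const * \<bar>t\<bar> ^ 3 * (\<bar>b\<bar> ^ 3 + \<bar>c\<bar> ^ 3) + t\<^sup>2 * c\<^sup>2 / 2 + t ^ 4 * b ^ 4"
proof -
  interpret N: prob_space std_normal_distribution by (rule prob_space_normal_density) simp
  let ?X = "\<lambda>x::real. b * (x\<^sup>2 - 1) + c * x"
  have "?X = (\<lambda>x. 0 * x ^ 4 + 0 * x ^ 3 + b * x\<^sup>2 + c * x + (- b))"
    by (auto simp: fun_eq_iff algebra_simps)
  then have "has_bochner_integral std_normal_distribution ?X (3 * 0 + b + (- b))"
    by (simp only: has_bochner_integral_std_normal_quartic)
  then have iX: "integrable std_normal_distribution ?X" and eX: "N.expectation ?X = 0"
    by (auto simp: has_bochner_integral_iff)
  have "(\<lambda>x. (?X x)\<^sup>2) = (\<lambda>x. b\<^sup>2 * x ^ 4 + 2*b*c * x ^ 3 + (c\<^sup>2 - 2*b\<^sup>2) * x\<^sup>2 + (-2*b*c) * x + b\<^sup>2)"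
    by (rule ext) algebra
  then have "has_bochner_integral std_normal_distribution (\<lambda>x. (?X x)\<^sup>2) (3 * b\<^sup>2 + (c\<^sup>2 - 2*b\<^sup>2) + b\<^sup>2)"
    by (simp only: has_bochner_integral_std_normal_quartic)
  then have iX2: "integrable std_normal_distribution (\<lambda>x. (?X x)\<^sup>2)"
    and "N.expectation (\<lambda>x. (?X x)\<^sup>2) = 2 * b\<^sup>2 + c\<^sup>2"
    by (auto simp: has_bochner_integral_iff)
  then have vX: "N.variance ?X = 2 * b\<^sup>2 + c\<^sup>2" unfolding eX by simp
  have 1: "cmod (char (distr std_normal_distribution borel ?X) t - (1 - t\<^sup>2 * (2 * b\<^sup>2 + c\<^sup>2) / 2))
     \<le> t\<^sup>2 / 6 * N.expectation (\<lambda>x. min (6 * (?X x)\<^sup>2) (\<bar>t\<bar> * \<bar>?X x\<bar>^3))"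
    by (rule N.char_approx3'[OF _ iX iX2 eX vX refl]) simp
  \<comment> \<open>The cubic branch of the minimum is kept. Both |x| and |x^2 - 1| are at most x^2
    + 1, so the single moment \<open>gauss_const\<close> controls the third moments of the linear
    and of the quadratic part together.\<close>
  have pt: "min (6 * (?X x)\<^sup>2) (\<bar>t\<bar> * \<bar>?X x\<bar>^3)
      \<le> (\<bar>t\<bar> * (4 * (\<bar>b\<bar> ^ 3 + \<bar>c\<bar> ^ 3))) * (x\<^sup>2 + 1) ^ 3" for x
  proof -
    have "\<bar>x\<bar> \<le> x\<^sup>2 + 1"
      using zero_le_power2[of "\<bar>x\<bar> - 1/2"] by (simp add: power2_eq_square algebra_simps)
    then have x: "\<bar>x\<bar> ^ 3 \<le> (x\<^sup>2 + 1) ^ 3" by (intro power_mono) auto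
    have "\<bar>x\<^sup>2 - 1\<bar> \<le> x\<^sup>2 + 1" by (simp add: abs_le_iff)
    then have x2: "\<bar>x\<^sup>2 - 1\<bar> ^ 3 \<le> (x\<^sup>2 + 1) ^ 3" by (intro power_mono) auto
    have "\<bar>?X x\<bar> ^ 3 \<le> (\<bar>b\<bar> * \<bar>x\<^sup>2 - 1\<bar> + \<bar>c\<bar> * \<bar>x\<bar>) ^ 3"
      by (intro power_mono) (auto simp flip: abs_mult)
    also have "\<dots> \<le> 4 * ((\<bar>b\<bar> * \<bar>x\<^sup>2 - 1\<bar>) ^ 3 + (\<bar>c\<bar> * \<bar>x\<bar>) ^ 3)"
      by (rule cube_add_le) auto
    also have "\<dots> \<le> 4 * (\<bar>b\<bar> ^ 3 * (x\<^sup>2 + 1) ^ 3 + \<bar>c\<bar> ^ 3 * (x\<^sup>2 + 1) ^ 3)"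
      unfolding power_mult_distrib
      by (intro mult_left_mono add_mono x x2) auto
    finally have "\<bar>t\<bar> * \<bar>?X x\<bar> ^ 3 \<le> \<bar>t\<bar> * (4 * (\<bar>b\<bar> ^ 3 * (x\<^sup>2 + 1) ^ 3 + \<bar>c\<bar> ^ 3 * (x\<^sup>2 + 1) ^ 3))"
      by (intro mult_left_mono) auto
    then show ?thesis by (simp add: algebra_simps min.coboundedI2)
  qed
  have "N.expectation (\<lambda>x. min (6 * (?X x)\<^sup>2) (\<bar>t\<bar> * \<bar>?X x\<bar>^3))
      \<le> N.expectation (\<lambda>x. (\<bar>t\<bar> * (4 * (\<bar>b\<bar> ^ 3 + \<bar>c\<bar> ^ 3))) * (x\<^sup>2 + 1) ^ 3)"
    by (rule integral_mono_AE'[OF integrable_mult_right[OF integrable_gauss_const] AE_I2[OF pt]])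
       (auto intro!: AE_I2)
  also have "\<dots> = (\<bar>t\<bar> * (4 * (\<bar>b\<bar> ^ 3 + \<bar>c\<bar> ^ 3))) * gauss_const"
    unfolding gauss_const_def by simp
  finally have "t\<^sup>2 / 6 * N.expectation (\<lambda>x. min (6 * (?X x)\<^sup>2) (\<bar>t\<bar> * \<bar>?X x\<bar>^3))
      \<le> t\<^sup>2 / 6 * ((\<bar>t\<bar> * (4 * (\<bar>b\<bar> ^ 3 + \<bar>c\<bar> ^ 3))) * gauss_const)"
    by (intro mult_left_mono) auto
  also have "\<dots> = 4 / 6 * (gauss_const * \<bar>t\<bar> ^ 3 * (\<bar>b\<bar> ^ 3 + \<bar>c\<bar> ^ 3))"
    by (simp add: power3_eq_cube power2_eq_square)
  also have "\<dots> \<le> gauss_const * \<bar>t\<bar> ^ 3 * (\<bar>b\<bar> ^ 3 + \<bar>c\<bar> ^ 3)"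
    using gauss_const_nonneg by (intro mult_left_le_one_le) auto
  finally have 2: "cmod (char (distr std_normal_distribution borel ?X) t - (1 - t\<^sup>2 * (2 * b\<^sup>2 + c\<^sup>2) / 2))
     \<le> gauss_const * \<bar>t\<bar> ^ 3 * (\<bar>b\<bar> ^ 3 + \<bar>c\<bar> ^ 3)"
    using 1 by linarith
  have eq: "(1 - t\<^sup>2 * (2 * b\<^sup>2 + c\<^sup>2) / 2) - exp (- (t\<^sup>2 * b\<^sup>2))
      = (1 - t\<^sup>2 * b\<^sup>2 - exp (- (t\<^sup>2 * b\<^sup>2))) - t\<^sup>2 * c\<^sup>2 / 2"
    by (simp add: field_simps)
  have "\<bar>(1 - t\<^sup>2 * (2 * b\<^sup>2 + c\<^sup>2) / 2) - exp (- (t\<^sup>2 * b\<^sup>2))\<bar>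
      \<le> (t\<^sup>2 * b\<^sup>2)\<^sup>2 + t\<^sup>2 * c\<^sup>2 / 2"
    unfolding eq
    by (rule order_trans[OF abs_triangle_ineq4 add_mono[OF exp_minus_linear_bound]]) auto
  also have "(t\<^sup>2 * b\<^sup>2)\<^sup>2 = t ^ 4 * b ^ 4"
    by (simp add: power_mult_distrib flip: power_mult)
  finally have 3: "cmod (complex_of_real (1 - t\<^sup>2 * (2 * b\<^sup>2 + c\<^sup>2) / 2) - complex_of_real (exp (- (t\<^sup>2 * b\<^sup>2))))
      \<le> t ^ 4 * b ^ 4 + t\<^sup>2 * c\<^sup>2 / 2"
    unfolding of_real_diff[symmetric] norm_of_real .
  have "cmod (char (distr std_normal_distribution borel ?X) t - complex_of_real (exp (- (t\<^sup>2 * b\<^sup>2))))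
    \<le> cmod (char (distr std_normal_distribution borel ?X) t - complex_of_real (1 - t\<^sup>2 * (2 * b\<^sup>2 + c\<^sup>2) / 2))
     + cmod (complex_of_real (1 - t\<^sup>2 * (2 * b\<^sup>2 + c\<^sup>2) / 2) - complex_of_real (exp (- (t\<^sup>2 * b\<^sup>2))))"
    by norm
  then show ?thesis using 2 3 by simp
qed

section \<open>Gaussian noise and characteristic functions\<close>

lemma prob_space_noise: "prob_space noise"
  unfolding noise_def by (intro prob_space_PiM prob_space_normal_density) simp

lemma measurable_noise_component [measurable]: "(\<lambda>\<omega>. \<omega> j) \<in> borel_measurable noise"
  unfolding noise_def by measurable

lemma distr_noise_component: "distr noise borel (\<lambda>\<omega>. \<omega> j) = std_normal_distribution"
proof -
  have "distr noise borel (\<lambda>\<omega>. \<omega> j) = distr noise std_normal_distribution (\<lambda>\<omega>. \<omega> j)"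
    by (rule distr_cong) auto
  also have "\<dots> = std_normal_distribution"
    unfolding noise_def
    by (rule distr_PiM_component) (auto intro: prob_space_normal_density)
  finally show ?thesis .
qed

lemma indep_vars_noise:
  "prob_space.indep_vars noise (\<lambda>_. borel) (\<lambda>j \<omega>. \<omega> j) UNIV"
proof -
  have sets: "sets noise = sets (Pi\<^sub>M UNIV (\<lambda>_::nat. borel :: real measure))"
    unfolding noise_def by (intro sets_PiM_cong) auto
  show ?thesis
  proof (subst prob_space.indep_vars_iff_distr_eq_PiM[OF prob_space_noise])
    have "distr noise (Pi\<^sub>M UNIV (\<lambda>_::nat. borel :: real measure)) (\<lambda>x. x) = noise"
      by (rule distr_id2) (simp add: sets)
    then show "distr noise (Pi\<^sub>M UNIV (\<lambda>_. borel)) (\<lambda>x. \<lambda>i\<in>UNIV. x i)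
        = Pi\<^sub>M UNIV (\<lambda>i. distr noise borel (\<lambda>\<omega>. \<omega> i))"
      by (simp add: distr_noise_component restrict_def) (simp add: noise_def)
  qed auto
qed

text \<open>For a partial sum, independence turns the characteristic function into a product, and
  the distance of two products of factors of modulus at most 1 is at most the sum of the distances
  of the factors. One factor of each higher power is then pulled out through the maximal coefficient
  (\<open>\<beta>\<close> or \<open>sqrt V\<close>), leaving sums of squares. Squares of
  \<open>b\<close> summing to 1/2 mean unit variance of the quadratic part. The bound is uniform in
  the number of terms, so it survives the limit.\<close>

lemma char_noise_quadratic_form_bound:
  fixes b c :: "nat \<Rightarrow> real" and Y :: "(nat \<Rightarrow> real) \<Rightarrow> real" and \<beta> t :: real
  assumes b: "\<And>j. 0 \<le> b j" "\<And>j. b j \<le> \<beta>" "(\<lambda>j. (b j)\<^sup>2) sums (1/2)"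
    and c: "summable (\<lambda>j. (c j)\<^sup>2)"
    and Y [measurable]: "Y \<in> borel_measurable noise"
    and sums: "AE \<omega> in noise. (\<lambda>j. b j * ((\<omega> (Suc j))\<^sup>2 - 1) + c j * \<omega> (Suc j)) sums Y \<omega>"
  defines "V \<equiv> \<Sum>j. (c j)\<^sup>2"
  shows "cmod (char (distr noise borel Y) t - complex_of_real (exp (- (t\<^sup>2) / 2)))
    \<le> gauss_const * \<bar>t\<bar> ^ 3 * (\<beta> / 2 + sqrt V * V) + t\<^sup>2 * V / 2 + t ^ 4 * (\<beta>\<^sup>2 / 2)"
    (is "_ \<le> ?B")
proof -
  interpret noise: prob_space noise by (rule prob_space_noise)
  define g where "g = (\<lambda>j x. b j * (x\<^sup>2 - 1) + c j * x)"
  define S where "S = (\<lambda>N \<omega>. \<Sum>j<N. g j (\<omega> (Suc j)))"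
  have [measurable]: "g j \<in> borel_measurable borel" for j unfolding g_def by measurable
  have [measurable]: "S N \<in> borel_measurable noise" for N unfolding S_def by measurable
  have V0: "0 \<le> V" unfolding V_def by (intro suminf_nonneg c) auto
  have \<beta>0: "0 \<le> \<beta>" using b(1)[of 0] b(2)[of 0] by linarith
  have cV: "\<bar>c j\<bar> \<le> sqrt V" for j
  proof -
    have "(c j)\<^sup>2 \<le> V" unfolding V_def using sum_le_suminf[OF c, of "{j}"] by simp
    then show ?thesis using real_le_rsqrt by fastforce
  qed
  have sb: "(\<Sum>j<N. (b j)\<^sup>2) \<le> 1/2" for N
    using sum_le_suminf[OF sums_summable[OF b(3)], of "{..<N}"] sums_unique[OF b(3)] by simp
  have sc: "(\<Sum>j<N. (c j)\<^sup>2) \<le> V" for N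
    unfolding V_def by (intro sum_le_suminf c) auto
  have conv: "(\<lambda>N. char (distr noise borel (S N)) t) \<longlonglongrightarrow> char (distr noise borel Y) t"
  proof -
    have "(\<lambda>N. CLINT \<omega>|noise. iexp (t * S N \<omega>)) \<longlonglongrightarrow> (CLINT \<omega>|noise. iexp (t * Y \<omega>))"
    proof (rule integral_dominated_convergence[where w = "\<lambda>_. 1"])
      show "AE \<omega> in noise. (\<lambda>N. iexp (t * S N \<omega>)) \<longlonglongrightarrow> iexp (t * Y \<omega>)"
        using sums
      proof eventually_elim
        case (elim \<omega>)
        then have "(\<lambda>N. S N \<omega>) \<longlonglongrightarrow> Y \<omega>" unfolding sums_def S_def g_def .
        then show ?case by (intro tendsto_intros)
      qed
    qed auto
    then show ?thesis by (simp add: char_def integral_distr)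
  qed
  have charS: "char (distr noise borel (S N)) t
      = (\<Prod>j<N. char (distr std_normal_distribution borel (g j)) t)" for N
  proof -
    \<comment> \<open>Summand j reads coordinate \<open>Suc j\<close>, so independence is used on
      the image of \<open>Suc\<close>, and \<open>j - 1\<close> undoes the shift.\<close>
    have ind: "noise.indep_vars (\<lambda>_. borel) (\<lambda>j \<omega>. g (j - 1) (\<omega> j)) (Suc ` {..<N})"
      by (rule noise.indep_vars_compose2[OF noise.indep_vars_subset[OF indep_vars_noise]]) auto
    have S: "S N = (\<lambda>\<omega>. \<Sum>j\<in>Suc ` {..<N}. g (j - 1) (\<omega> j))"
      unfolding S_def by (simp add: sum.reindex)
    have "distr noise borel (\<lambda>\<omega>. g j (\<omega> (Suc j))) = distr std_normal_distribution borel (g j)" for j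
      by (subst distr_noise_component[of "Suc j", symmetric], subst distr_distr) (auto simp: comp_def)
    then show ?thesis unfolding S noise.char_distr_sum[OF ind] by (simp add: prod.reindex)
  qed
  have bound: "cmod (char (distr noise borel (S N)) t - complex_of_real (exp (- (t\<^sup>2 * (\<Sum>j<N. (b j)\<^sup>2))))) \<le> ?B" for N
  proof -
    \<comment> \<open>The exponential of the partial sum factorises over the same index set, which
      makes the two products comparable term by term.\<close>
    have e: "complex_of_real (exp (- (t\<^sup>2 * (\<Sum>j<N. (b j)\<^sup>2)))) = (\<Prod>j<N. complex_of_real (exp (- (t\<^sup>2 * (b j)\<^sup>2))))"
      by (simp add: sum_distrib_left exp_sum sum_negf[symmetric] del: of_real_exp)
    have rd: "real_distribution (distr std_normal_distribution borel (g j))" for j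
      by (intro prob_space.real_distribution_distr prob_space_normal_density) auto
    have "cmod (char (distr noise borel (S N)) t - complex_of_real (exp (- (t\<^sup>2 * (\<Sum>j<N. (b j)\<^sup>2)))))
      \<le> (\<Sum>j<N. cmod (char (distr std_normal_distribution borel (g j)) t - complex_of_real (exp (- (t\<^sup>2 * (b j)\<^sup>2)))))"
      unfolding charS e
      by (intro norm_prod_diff real_distribution.cmod_char_le_1 rd) (simp del: of_real_exp)
    also have "\<dots> \<le> (\<Sum>j<N. gauss_const * \<bar>t\<bar> ^ 3 * (\<beta> * (b j)\<^sup>2 + sqrt V * (c j)\<^sup>2)
         + t\<^sup>2 * (c j)\<^sup>2 / 2 + t ^ 4 * (\<beta>\<^sup>2 * (b j)\<^sup>2))"
    proof (rule sum_mono)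
      fix j
      have 1: "\<bar>b j\<bar> ^ 3 \<le> \<beta> * (b j)\<^sup>2"
        using mult_right_mono[OF b(2)[of j], of "(b j)\<^sup>2"] b(1)[of j]
        by (simp add: power3_eq_cube power2_eq_square mult.assoc)
      have 2: "\<bar>c j\<bar> ^ 3 \<le> sqrt V * (c j)\<^sup>2"
        using mult_right_mono[OF cV[of j], of "(c j)\<^sup>2"]
        by (simp add: power3_eq_cube power2_eq_square mult.assoc)
      have 3: "b j ^ 4 \<le> \<beta>\<^sup>2 * (b j)\<^sup>2"
      proof -
        have "(b j)\<^sup>2 \<le> \<beta>\<^sup>2" using b(1,2)[of j] by (intro power_mono)
        then have "(b j)\<^sup>2 * (b j)\<^sup>2 \<le> \<beta>\<^sup>2 * (b j)\<^sup>2" by (intro mult_right_mono) auto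
        then show ?thesis by (simp flip: power_add)
      qed
      have "cmod (char (distr std_normal_distribution borel (g j)) t - complex_of_real (exp (- (t\<^sup>2 * (b j)\<^sup>2))))
         \<le> gauss_const * \<bar>t\<bar> ^ 3 * (\<bar>b j\<bar> ^ 3 + \<bar>c j\<bar> ^ 3) + t\<^sup>2 * (c j)\<^sup>2 / 2 + t ^ 4 * b j ^ 4"
        unfolding g_def by (rule char_quadratic_gaussian)
      also have "\<dots> \<le> gauss_const * \<bar>t\<bar> ^ 3 * (\<beta> * (b j)\<^sup>2 + sqrt V * (c j)\<^sup>2)
         + t\<^sup>2 * (c j)\<^sup>2 / 2 + t ^ 4 * (\<beta>\<^sup>2 * (b j)\<^sup>2)"
        using gauss_const_nonneg by (intro add_mono mult_left_mono 1 2 3 order_refl) auto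
      finally show "cmod (char (distr std_normal_distribution borel (g j)) t - complex_of_real (exp (- (t\<^sup>2 * (b j)\<^sup>2))))
        \<le> gauss_const * \<bar>t\<bar> ^ 3 * (\<beta> * (b j)\<^sup>2 + sqrt V * (c j)\<^sup>2)
         + t\<^sup>2 * (c j)\<^sup>2 / 2 + t ^ 4 * (\<beta>\<^sup>2 * (b j)\<^sup>2)" .
    qed
    also have "\<dots> = gauss_const * \<bar>t\<bar> ^ 3 * (\<beta> * (\<Sum>j<N. (b j)\<^sup>2) + sqrt V * (\<Sum>j<N. (c j)\<^sup>2))
         + t\<^sup>2 * (\<Sum>j<N. (c j)\<^sup>2) / 2 + t ^ 4 * (\<beta>\<^sup>2 * (\<Sum>j<N. (b j)\<^sup>2))"
      by (simp add: sum.distrib sum_distrib_left sum_divide_distrib distrib_left)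
    also have "\<dots> \<le> gauss_const * \<bar>t\<bar> ^ 3 * (\<beta> * (1/2) + sqrt V * V)
         + t\<^sup>2 * V / 2 + t ^ 4 * (\<beta>\<^sup>2 * (1/2))"
      using gauss_const_nonneg V0 \<beta>0
      by (intro add_mono mult_left_mono divide_right_mono sb sc order_refl) auto
    finally show ?thesis by simp
  qed
  have "(\<lambda>N. \<Sum>j<N. (b j)\<^sup>2) \<longlonglongrightarrow> 1/2" using b(3) unfolding sums_def .
  then have "(\<lambda>N. complex_of_real (exp (- (t\<^sup>2 * (\<Sum>j<N. (b j)\<^sup>2))))) \<longlonglongrightarrow> complex_of_real (exp (- (t\<^sup>2 * (1/2))))"
    by (intro tendsto_intros)
  then have "(\<lambda>N. cmod (char (distr noise borel (S N)) t - complex_of_real (exp (- (t\<^sup>2 * (\<Sum>j<N. (b j)\<^sup>2))))))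
     \<longlonglongrightarrow> cmod (char (distr noise borel Y) t - complex_of_real (exp (- (t\<^sup>2 * (1/2)))))"
    by (intro tendsto_norm tendsto_diff conv)
  then have "cmod (char (distr noise borel Y) t - complex_of_real (exp (- (t\<^sup>2 * (1/2))))) \<le> ?B"
    by (rule LIMSEQ_le_const2) (use bound in auto)
  then show ?thesis by simp
qed

text \<open>By monotone convergence the expectation of the series of nonnegative terms is the sum of
  the \<open>v j\<close>, which is finite; a variable with finite expectation is finite almost
  surely.\<close>

lemma AE_noise_summable:
  fixes v :: "nat \<Rightarrow> real"
  assumes "\<And>j. 0 \<le> v j" "summable v"
  shows "AE \<omega> in noise. summable (\<lambda>j. v j * (\<omega> (Suc j))\<^sup>2)"
proof -
  have 1: "(\<integral>\<^sup>+ \<omega>. ennreal (v j * (\<omega> (Suc j))\<^sup>2) \<partial>noise) = ennreal (v j)" for j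
  proof -
    have hb: "has_bochner_integral std_normal_distribution (\<lambda>x. v j * x\<^sup>2) (v j)"
      using has_bochner_integral_std_normal_quartic[of 0 0 "v j" 0 0] by simp
    have "(\<integral>\<^sup>+ \<omega>. ennreal (v j * (\<omega> (Suc j))\<^sup>2) \<partial>noise)
       = (\<integral>\<^sup>+ x. ennreal (v j * x\<^sup>2) \<partial>distr noise borel (\<lambda>\<omega>. \<omega> (Suc j)))"
      by (subst nn_integral_distr) auto
    also have "\<dots> = ennreal (v j)"
      unfolding distr_noise_component
      using hb assms by (subst nn_integral_eq_integral) (auto simp: has_bochner_integral_iff)
    finally show ?thesis .
  qed
  have "(\<integral>\<^sup>+ \<omega>. (\<Sum>j. ennreal (v j * (\<omega> (Suc j))\<^sup>2)) \<partial>noise) = (\<Sum>j. ennreal (v j))"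
    by (subst nn_integral_suminf) (auto simp: 1)
  also have "\<dots> \<noteq> \<infinity>" using assms by (simp add: suminf_ennreal2)
  finally have "AE \<omega> in noise. (\<Sum>j. ennreal (v j * (\<omega> (Suc j))\<^sup>2)) \<noteq> \<infinity>"
    by (intro nn_integral_PInf_AE) auto
  then show ?thesis
    by eventually_elim (use assms in \<open>auto intro!: summable_suminf_not_top\<close>)
qed

section \<open>Asymptotic normality of the test statistic\<close>

lemma measurable_Tstat [measurable]: "Tstat \<sigma> w n \<theta> \<in> borel_measurable noise"
  unfolding Tstat_def by measurable

lemma summable_weighted_squares:
  fixes v \<theta> :: "nat \<Rightarrow> real"
  assumes "\<And>j. 0 \<le> v j" "\<And>j. v j \<le> B" "summable (\<lambda>j. (\<theta> j)\<^sup>2)"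
  shows "summable (\<lambda>j. v j * (\<theta> j)\<^sup>2)"
  by (rule summable_comparison_test'[where N = 0, OF summable_mult[OF assms(3), of B]])
     (use assms in \<open>auto simp: abs_mult intro!: mult_right_mono\<close>)

text \<open>Expanding the square splits the centred statistic into a quadratic and a linear part in
  the noise. As \<open>suminf\<close> is informative only for convergent series, the expansion is
  claimed on the almost sure event where the weighted squares of the noise are summable.\<close>

lemma AE_Tstat_sums:
  fixes \<sigma> B :: real and w :: "nat \<Rightarrow> nat \<Rightarrow> real" and n :: nat and \<theta> :: "nat \<Rightarrow> real"
  assumes w: "\<And>j. 0 \<le> w n (Suc j)" "\<And>j. w n (Suc j) \<le> B" "summable (\<lambda>j. w n (Suc j))"
    and \<theta>: "in_L2 \<theta>" and n: "n \<ge> 1"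
  defines "a \<equiv> \<sigma> / sqrt (real n)"
  shows "AE \<omega> in noise. (\<lambda>j. w n (Suc j) * a\<^sup>2 * ((\<omega> (Suc j))\<^sup>2 - 1) + 2 * w n (Suc j) * \<theta> (Suc j) * a * \<omega> (Suc j))
     sums (Tstat \<sigma> w n \<theta> \<omega> - (\<Sum>j. w n (Suc j) * (\<theta> (Suc j))\<^sup>2))"
  using AE_noise_summable[of "\<lambda>j. w n (Suc j)", OF w(1,3)]
proof eventually_elim
  case (elim \<omega>)
  have s2: "summable (\<lambda>j. w n (Suc j) * (\<theta> (Suc j))\<^sup>2)"
    using w \<theta> by (intro summable_weighted_squares) (auto simp: in_L2_def)
  \<comment> \<open>The cross term is absorbed by (x + y)^2 <= 2 x^2 + 2 y^2, so both squares can be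
    controlled separately.\<close>
  have s3: "summable (\<lambda>j. w n (Suc j) * (\<theta> (Suc j) + a * \<omega> (Suc j))\<^sup>2)"
  proof (rule summable_comparison_test')
    show "summable (\<lambda>j. 2 * (w n (Suc j) * (\<theta> (Suc j))\<^sup>2) + 2 * a\<^sup>2 * (w n (Suc j) * (\<omega> (Suc j))\<^sup>2))"
      by (intro summable_add summable_mult s2 elim)
    fix j
    have "(\<theta> (Suc j) + a * \<omega> (Suc j))\<^sup>2 \<le> 2 * (\<theta> (Suc j))\<^sup>2 + 2 * a\<^sup>2 * (\<omega> (Suc j))\<^sup>2"
      using zero_le_power2[of "\<theta> (Suc j) - a * \<omega> (Suc j)"] by (simp add: power2_eq_square algebra_simps)
    from mult_left_mono[OF this w(1)[of j]]
    show "norm (w n (Suc j) * (\<theta> (Suc j) + a * \<omega> (Suc j))\<^sup>2)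
       \<le> 2 * (w n (Suc j) * (\<theta> (Suc j))\<^sup>2) + 2 * a\<^sup>2 * (w n (Suc j) * (\<omega> (Suc j))\<^sup>2)"
      using w(1)[of j] by (simp add: abs_mult algebra_simps)
  qed
  have a2: "a\<^sup>2 = \<sigma>\<^sup>2 / real n" unfolding a_def by (simp add: power_divide)
  have "(\<lambda>j. w n (Suc j) * (\<theta> (Suc j) + a * \<omega> (Suc j))\<^sup>2 - a\<^sup>2 * w n (Suc j) - w n (Suc j) * (\<theta> (Suc j))\<^sup>2)
     sums (Tstat \<sigma> w n \<theta> \<omega> - (\<Sum>j. w n (Suc j) * (\<theta> (Suc j))\<^sup>2))"
    unfolding Tstat_def rho_def a_def[symmetric] a2[symmetric]
    by (intro sums_diff sums_mult summable_sums s2 s3 w)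
  moreover have "w n (Suc j) * (\<theta> (Suc j) + a * \<omega> (Suc j))\<^sup>2 - a\<^sup>2 * w n (Suc j) - w n (Suc j) * (\<theta> (Suc j))\<^sup>2
      = w n (Suc j) * a\<^sup>2 * ((\<omega> (Suc j))\<^sup>2 - 1) + 2 * w n (Suc j) * \<theta> (Suc j) * a * \<omega> (Suc j)" for j
    by (simp add: power2_eq_square algebra_simps)
  ultimately show ?case by simp
qed

text \<open>Mean of the statistic under \<open>\<theta>\<close>, and its standard deviation under the null hypothesis.\<close>

definition signal_shift :: "(nat \<Rightarrow> nat \<Rightarrow> real) \<Rightarrow> nat \<Rightarrow> (nat \<Rightarrow> real) \<Rightarrow> real" where
  "signal_shift w n \<theta> = (\<Sum>j. w n (Suc j) * (\<theta> (Suc j))\<^sup>2)"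

definition null_scale :: "real \<Rightarrow> (nat \<Rightarrow> nat \<Rightarrow> real) \<Rightarrow> nat \<Rightarrow> real" where
  "null_scale \<sigma> w n = \<sigma>\<^sup>2 / real n * sqrt (2 * (\<Sum>j. (w n (Suc j))\<^sup>2))"

abbreviation Phi :: "real \<Rightarrow> real" where "Phi \<equiv> cdf std_normal_distribution"

text \<open>A law with a density has no atoms. Hence every point is a continuity point, and weak
  convergence yields convergence of the distribution functions everywhere.\<close>

lemma isCont_Phi: "isCont Phi x"
proof -
  interpret N: real_distribution std_normal_distribution by (rule real_dist_normal_dist)
  have "emeasure std_normal_distribution {x} = 0"
    by (subst emeasure_density) (auto simp: nn_integral_indicator_singleton)
  then show ?thesis by (simp add: N.isCont_cdf measure_def)
qed

text \<open>The density is positive everywhere, so an interval of Gaussian measure zero would be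
  Lebesgue null. Strictness is what converts a shift by a fixed multiple of the scale into a fixed
  gap between error probabilities.\<close>

lemma Phi_strict_mono: "x < y \<Longrightarrow> Phi x < Phi y"
proof -
  assume xy: "x < y"
  interpret N: real_distribution std_normal_distribution by (rule real_dist_normal_dist)
  have "emeasure std_normal_distribution {x<..y} \<noteq> 0"
  proof
    assume "emeasure std_normal_distribution {x<..y} = 0"
    then have "{x<..y} \<in> null_sets std_normal_distribution" by (auto intro: null_setsI)
    then have "AE z in lborel. z \<in> {x<..y} \<longrightarrow> ennreal (std_normal_density z) = 0"
      by (subst (asm) null_sets_density_iff) auto
    then have "AE z in lborel. z \<notin> {x<..y}"
    proof eventually_elim
      case (elim z)
      moreover have "ennreal (std_normal_density z) \<noteq> 0"
        using normal_density_pos[of 1 0 z] by (simp add: ennreal_eq_0_iff not_le)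
      ultimately show ?case by blast
    qed
    then have "emeasure lborel {x<..y} = 0"
      by (subst (asm) AE_iff_measurable[where N = "{x<..y}"]) auto
    then show False using xy by simp
  qed
  then have "measure std_normal_distribution {x<..y} > 0"
    using measure_nonneg[of std_normal_distribution "{x<..y}"]
    by (simp add: N.emeasure_eq_measure less_le)
  then show ?thesis using N.cdf_diff_eq[OF xy] by simp
qed

lemma Phi_surj:
  assumes "0 < p" "p < 1"
  obtains z where "Phi z = p"
proof -
  interpret N: real_distribution std_normal_distribution by (rule real_dist_normal_dist)
  have "eventually (\<lambda>x. Phi x < p) at_bot" by (rule order_tendstoD(2)[OF N.cdf_lim_at_bot assms(1)])
  then obtain a where a: "Phi a < p" by (auto simp: eventually_at_bot_linorder)
  have "eventually (\<lambda>x. p < Phi x) at_top" by (rule order_tendstoD(1)[OF N.cdf_lim_at_top_prob assms(2)])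
  then obtain b where b: "p < Phi b" by (auto simp: eventually_at_top_linorder)
  have "a \<le> b" using a b N.cdf_nondecreasing[of b a] by (cases "a \<le> b") auto
  then obtain z where "Phi z = p"
    using IVT[of Phi a p b] a b isCont_Phi by (auto simp: less_imp_le)
  then show thesis by (rule that)
qed

text \<open>The standardised statistic is a quadratic form to which the characteristic function
  bound applies, and \<open>lim1\<close> and \<open>lim2\<close> send that bound to 0; Levy
  continuity concludes. The null standard deviation is the right scale under the alternative as
  well, since \<open>lim2\<close> makes the variance of the cross terms negligible.\<close>

lemma Tstat_asymptotically_normal:
  fixes \<sigma> :: real and w \<theta> :: "nat \<Rightarrow> nat \<Rightarrow> real"
  assumes \<sigma>: "\<sigma> > 0"
    and w: "\<And>n j. 0 \<le> w n j" "\<And>n j. n \<ge> 1 \<Longrightarrow> w n (Suc j) \<le> w n 1"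
      "\<And>n. n \<ge> 1 \<Longrightarrow> summable (\<lambda>j. w n (Suc j))"
      "\<And>n. n \<ge> 1 \<Longrightarrow> summable (\<lambda>j. (w n (Suc j))\<^sup>2)"
      "\<And>n. n \<ge> 1 \<Longrightarrow> 0 < (\<Sum>j. (w n (Suc j))\<^sup>2)"
    and \<theta>: "\<And>n. n \<ge> 1 \<Longrightarrow> in_L2 (\<theta> n)"
    and lim1: "(\<lambda>n. w n 1 / sqrt (\<Sum>j. (w n (Suc j))\<^sup>2)) \<longlonglongrightarrow> 0"
    and lim2: "(\<lambda>n. (w n 1)\<^sup>2 * l2sq (\<theta> n) * real n / (\<Sum>j. (w n (Suc j))\<^sup>2)) \<longlonglongrightarrow> 0"
  shows "(\<lambda>n. measure noise {\<omega> \<in> space noise. Tstat \<sigma> w n (\<theta> n) \<omega> \<le> signal_shift w n (\<theta> n) + u * null_scale \<sigma> w n})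
    \<longlonglongrightarrow> Phi u"
proof -
  interpret noise: prob_space noise by (rule prob_space_noise)
  define W where "W = (\<lambda>n. \<Sum>j. (w n (Suc j))\<^sup>2)"
  define Y where "Y = (\<lambda>n \<omega>. (Tstat \<sigma> w n (\<theta> n) \<omega> - signal_shift w n (\<theta> n)) / null_scale \<sigma> w n)"
  have [measurable]: "Y n \<in> borel_measurable noise" for n unfolding Y_def by measurable
  \<comment> \<open>\<open>\<beta>\<close> is the largest weight after standardisation.
    \<open>V\<close> dominates the sum of squared linear coefficients: each one equals 2 w^2
    \<theta>^2 n / (\<sigma>^2 W), and w is replaced by the largest weight.\<close>
  define \<beta> where "\<beta> = (\<lambda>n. w n 1 / sqrt (W n) / sqrt 2)"
  define V where "V = (\<lambda>n. 2 / \<sigma>\<^sup>2 * ((w n 1)\<^sup>2 * l2sq (\<theta> n) * real n / W n))"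
  have \<beta>0: "\<beta> \<longlonglongrightarrow> 0" unfolding \<beta>_def W_def using tendsto_divide[OF lim1 tendsto_const[of "sqrt 2"]] by simp
  have V0: "V \<longlonglongrightarrow> 0" unfolding V_def W_def using tendsto_mult[OF tendsto_const[of "2 / \<sigma>\<^sup>2"] lim2] by simp
  have bound: "cmod (char (distr noise borel (Y n)) t - complex_of_real (exp (- (t\<^sup>2) / 2)))
    \<le> gauss_const * \<bar>t\<bar> ^ 3 * (\<beta> n / 2 + sqrt (V n) * V n) + t\<^sup>2 * V n / 2 + t ^ 4 * ((\<beta> n)\<^sup>2 / 2)"
    if n: "n \<ge> 1" for n t
  proof -
    define a where "a = \<sigma> / sqrt (real n)"
    have a: "a > 0" unfolding a_def using \<sigma> n by simp
    have a2: "a\<^sup>2 = \<sigma>\<^sup>2 / real n" unfolding a_def by (simp add: power_divide)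
    have W: "0 < W n" unfolding W_def using w(5)[OF n] .
    define D where "D = null_scale \<sigma> w n"
    have D: "D = a\<^sup>2 * sqrt (2 * W n)" unfolding D_def null_scale_def a2 W_def ..
    define b where "b = (\<lambda>j. w n (Suc j) * a\<^sup>2 / D)"
    define c where "c = (\<lambda>j. 2 * w n (Suc j) * \<theta> n (Suc j) * a / D)"
    have b_eq: "b j = w n (Suc j) / sqrt (2 * W n)" for j
      unfolding b_def D using a by simp
    have b0: "0 \<le> b j" for j unfolding b_eq using w(1) W by simp
    have b1: "b j \<le> \<beta> n" for j
      unfolding b_eq \<beta>_def real_sqrt_mult using w(2)[OF n, of j] W by (simp add: field_simps)
    have bs: "(\<lambda>j. (b j)\<^sup>2) sums (1/2)"
    proof -
      have "(\<lambda>j. (w n (Suc j))\<^sup>2 / (2 * W n)) sums (W n / (2 * W n))"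
        unfolding W_def using w(4)[OF n] by (intro sums_divide summable_sums)
      then show ?thesis using W by (simp add: b_eq power_divide)
    qed
    have c2: "(c j)\<^sup>2 = 2 / (a\<^sup>2 * W n) * ((w n (Suc j))\<^sup>2 * (\<theta> n (Suc j))\<^sup>2)" for j
      unfolding c_def D power_divide power_mult_distrib using a W
      by (simp add: field_simps power2_eq_square)
    have c_le: "(c j)\<^sup>2 \<le> 2 / (a\<^sup>2 * W n) * (w n 1)\<^sup>2 * (\<theta> n (Suc j))\<^sup>2" for j
    proof -
      have "(w n (Suc j))\<^sup>2 \<le> (w n 1)\<^sup>2" using w(1,2) n by (intro power_mono) auto
      then show ?thesis unfolding c2 mult.assoc using a W
        by (intro mult_left_mono mult_right_mono) auto
    qed
    have st: "summable (\<lambda>j. 2 / (a\<^sup>2 * W n) * (w n 1)\<^sup>2 * (\<theta> n (Suc j))\<^sup>2)"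
      using \<theta>[OF n] unfolding in_L2_def by (intro summable_mult)
    have cs: "summable (\<lambda>j. (c j)\<^sup>2)"
      by (rule summable_comparison_test'[where N = 0, OF st]) (use c_le in auto)
    have "(\<Sum>j. (c j)\<^sup>2) \<le> (\<Sum>j. 2 / (a\<^sup>2 * W n) * (w n 1)\<^sup>2 * (\<theta> n (Suc j))\<^sup>2)"
      by (intro suminf_le c_le cs st)
    also have "\<dots> = 2 / (a\<^sup>2 * W n) * (w n 1)\<^sup>2 * l2sq (\<theta> n)"
      unfolding l2sq_def using \<theta>[OF n] unfolding in_L2_def by (rule suminf_mult)
    also have "\<dots> = V n"
      unfolding V_def a2 using \<sigma> n W by (simp add: field_simps)
    finally have cV: "(\<Sum>j. (c j)\<^sup>2) \<le> V n" .
    have c0: "0 \<le> (\<Sum>j. (c j)\<^sup>2)" by (intro suminf_nonneg cs) auto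
    have "AE \<omega> in noise. (\<lambda>j. b j * ((\<omega> (Suc j))\<^sup>2 - 1) + c j * \<omega> (Suc j)) sums Y n \<omega>"
      using AE_Tstat_sums[where w = w and n = n and \<theta> = "\<theta> n" and \<sigma> = \<sigma>, OF w(1) w(2)[OF n] w(3)[OF n] \<theta>[OF n] n]
    proof eventually_elim
      case (elim \<omega>)
      from sums_divide[OF this, of D] show ?case
        unfolding Y_def signal_shift_def[symmetric] D_def[symmetric] a_def[symmetric] b_def c_def
        by (simp add: add_divide_distrib)
    qed
    from char_noise_quadratic_form_bound[OF b0 b1 bs cs _ this, of t]
    have "cmod (char (distr noise borel (Y n)) t - complex_of_real (exp (- (t\<^sup>2) / 2)))
      \<le> gauss_const * \<bar>t\<bar> ^ 3 * (\<beta> n / 2 + sqrt (\<Sum>j. (c j)\<^sup>2) * (\<Sum>j. (c j)\<^sup>2)) + t\<^sup>2 * (\<Sum>j. (c j)\<^sup>2) / 2 + t ^ 4 * ((\<beta> n)\<^sup>2 / 2)"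
      by simp
    also have "\<dots> \<le> gauss_const * \<bar>t\<bar> ^ 3 * (\<beta> n / 2 + sqrt (V n) * V n) + t\<^sup>2 * V n / 2 + t ^ 4 * ((\<beta> n)\<^sup>2 / 2)"
      using gauss_const_nonneg c0 cV
      by (intro add_mono mult_left_mono mult_mono divide_right_mono order_refl real_sqrt_le_mono) auto
    finally show ?thesis .
  qed
  have "weak_conv_m (\<lambda>n. distr noise borel (Y n)) std_normal_distribution"
  proof (rule levy_continuity)
    fix t :: real
    have "(\<lambda>n. gauss_const * \<bar>t\<bar> ^ 3 * (\<beta> n / 2 + sqrt (V n) * V n) + t\<^sup>2 * V n / 2 + t ^ 4 * ((\<beta> n)\<^sup>2 / 2))
       \<longlonglongrightarrow> gauss_const * \<bar>t\<bar> ^ 3 * (0 / 2 + sqrt 0 * 0) + t\<^sup>2 * 0 / 2 + t ^ 4 * (0\<^sup>2 / 2)"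
      by (intro tendsto_intros \<beta>0 V0) auto
    then have *: "(\<lambda>n. gauss_const * \<bar>t\<bar> ^ 3 * (\<beta> n / 2 + sqrt (V n) * V n) + t\<^sup>2 * V n / 2 + t ^ 4 * ((\<beta> n)\<^sup>2 / 2)) \<longlonglongrightarrow> 0"
      by simp
    have "(\<lambda>n. char (distr noise borel (Y n)) t - complex_of_real (exp (- (t\<^sup>2) / 2))) \<longlonglongrightarrow> 0"
      by (rule Lim_null_comparison[OF eventually_sequentiallyI[of 1] *]) (rule bound)
    then show "(\<lambda>n. char (distr noise borel (Y n)) t) \<longlonglongrightarrow> char std_normal_distribution t"
      unfolding char_std_normal_distribution by (rule LIM_zero_cancel)
  qed (auto intro!: real_dist_normal_dist noise.real_distribution_distr)
  then have "(\<lambda>n. cdf (distr noise borel (Y n)) u) \<longlonglongrightarrow> Phi u"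
    unfolding weak_conv_m_def weak_conv_def using isCont_Phi by blast
  moreover have "\<forall>\<^sub>F n in sequentially. cdf (distr noise borel (Y n)) u
     = measure noise {\<omega> \<in> space noise. Tstat \<sigma> w n (\<theta> n) \<omega> \<le> signal_shift w n (\<theta> n) + u * null_scale \<sigma> w n}"
  proof (rule eventually_sequentiallyI[of 1])
    fix n :: nat assume n: "1 \<le> n"
    have "null_scale \<sigma> w n > 0" unfolding null_scale_def using \<sigma> n w(5)[OF n] by simp
    then have "{\<omega> \<in> space noise. Y n \<omega> \<le> u} =
      {\<omega> \<in> space noise. Tstat \<sigma> w n (\<theta> n) \<omega> \<le> signal_shift w n (\<theta> n) + u * null_scale \<sigma> w n}"
      unfolding Y_def by (auto simp: field_simps)
    then show "cdf (distr noise borel (Y n)) u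
     = measure noise {\<omega> \<in> space noise. Tstat \<sigma> w n (\<theta> n) \<omega> \<le> signal_shift w n (\<theta> n) + u * null_scale \<sigma> w n}"
      by (simp add: cdf_def measure_distr vimage_def Int_def conj_commute)
  qed
  ultimately show ?thesis by (rule Lim_transform_eventually)
qed

section \<open>Consistency expressed through the mean shift of the statistic\<close>

lemma type1_eq: "type1 \<sigma> w n t = 1 - type2 \<sigma> w n t (\<lambda>_. 0)"
proof -
  interpret noise: prob_space noise by (rule prob_space_noise)
  have "{\<omega> \<in> space noise. Tstat \<sigma> w n (\<lambda>_. 0) \<omega> > t}
      = space noise - {\<omega> \<in> space noise. Tstat \<sigma> w n (\<lambda>_. 0) \<omega> \<le> t}"
    by auto
  then show ?thesis unfolding type1_def type2_def by (simp add: noise.prob_compl)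
qed

lemma type2_mono: "s \<le> t \<Longrightarrow> type2 \<sigma> w n s \<theta> \<le> type2 \<sigma> w n t \<theta>"
proof -
  interpret noise: prob_space noise by (rule prob_space_noise)
  assume "s \<le> t"
  then show ?thesis unfolding type2_def by (intro noise.finite_measure_mono) auto
qed

text \<open>On the scale \<open>null_scale\<close> the null law is asymptotically standard normal
  and the law under \<open>f n\<close> is its translate by the shift. A threshold near the quantile
  z thus has type II error close to Phi (z - shift / scale), which stays strictly below 1 - \<alpha>
  exactly when the ratio is eventually bounded away from 0. Arbitrary thresholds are compared with
  multiples of the scale by monotonicity of the error in the threshold.\<close>

lemma consistent_iff_shift:
  fixes \<sigma> :: real and w f :: "nat \<Rightarrow> nat \<Rightarrow> real"
  assumes \<sigma>: "\<sigma> > 0"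
    and w: "\<And>n j. 0 \<le> w n j" "\<And>n j. n \<ge> 1 \<Longrightarrow> w n (Suc j) \<le> w n 1"
      "\<And>n. n \<ge> 1 \<Longrightarrow> summable (\<lambda>j. w n (Suc j))"
      "\<And>n. n \<ge> 1 \<Longrightarrow> summable (\<lambda>j. (w n (Suc j))\<^sup>2)"
      "\<And>n. n \<ge> 1 \<Longrightarrow> 0 < (\<Sum>j. (w n (Suc j))\<^sup>2)"
    and f: "\<And>n. n \<ge> 1 \<Longrightarrow> in_L2 (f n)"
    and lim1: "(\<lambda>n. w n 1 / sqrt (\<Sum>j. (w n (Suc j))\<^sup>2)) \<longlonglongrightarrow> 0"
    and lim2: "(\<lambda>n. (w n 1)\<^sup>2 * l2sq (f n) * real n / (\<Sum>j. (w n (Suc j))\<^sup>2)) \<longlonglongrightarrow> 0"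
  shows "consistent \<sigma> w f \<longleftrightarrow>
    (\<exists>d>0. \<forall>\<^sub>F n in sequentially. d * null_scale \<sigma> w n \<le> signal_shift w n (f n))"
proof -
  define D where "D = null_scale \<sigma> w"
  define m where "m = (\<lambda>n. signal_shift w n (f n))"
  define A where "A = (\<lambda>n t. type2 \<sigma> w n t (\<lambda>_. 0))"
  define B where "B = (\<lambda>n t. type2 \<sigma> w n t (f n))"
  have Dpos: "\<forall>\<^sub>F n in sequentially. 0 < D n"
    by (rule eventually_sequentiallyI[of 1]) (use \<sigma> w(5) in \<open>simp add: D_def null_scale_def\<close>)
  have B: "(\<lambda>n. B n (m n + u * D n)) \<longlonglongrightarrow> Phi u" for u
    unfolding B_def type2_def m_def D_def by (rule Tstat_asymptotically_normal[OF assms])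
  have A: "(\<lambda>n. A n (u * D n)) \<longlonglongrightarrow> Phi u" for u
    unfolding A_def type2_def D_def
    using Tstat_asymptotically_normal[OF \<sigma> w _ lim1, of "\<lambda>_ _. 0" u]
    by (simp add: signal_shift_def in_L2_def l2sq_def)
  have "consistent \<sigma> w f \<longleftrightarrow> (\<exists>d>0. \<forall>\<^sub>F n in sequentially. d * D n \<le> m n)"
  proof
    assume cons: "consistent \<sigma> w f"
    interpret N: real_distribution std_normal_distribution by (rule real_dist_normal_dist)
    have 0: "0 < Phi 0" "Phi 0 < 1"
      using Phi_strict_mono[of "-1" 0] Phi_strict_mono[of 0 1] N.cdf_nonneg[of "-1"] N.cdf_bounded_prob[of 1]
      by linarith+
    \<comment> \<open>A single test suffices for this direction: threshold 0, whose asymptotic level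
      is 1 - Phi 0.\<close>
    have "(\<lambda>n. type1 \<sigma> w n 0 / (1 - Phi 0)) \<longlonglongrightarrow> (1 - Phi 0) / (1 - Phi 0)"
      unfolding type1_eq using A[of 0] 0 unfolding A_def
      by (intro tendsto_intros) auto
    then have "limsup (\<lambda>n. ereal (B n 0)) < ereal (Phi 0)"
      using cons[unfolded consistent_def, rule_format, of "1 - Phi 0" "\<lambda>_. 0"] 0
      unfolding B_def by simp
    then obtain q where q: "limsup (\<lambda>n. ereal (B n 0)) < ereal q" "q < Phi 0"
      using ereal_dense2[of "limsup (\<lambda>n. ereal (B n 0))" "ereal (Phi 0)"] by auto
    \<comment> \<open>Left continuity at 0 gives a negative x with Phi x still above q. The error at
      threshold 0 is eventually below q while the error at \<open>m n + x * D n\<close> is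
      eventually above it, so the latter threshold must be positive, and d = -x works.\<close>
    have "\<forall>\<^sub>F x in at_left 0. q < Phi x"
      using isCont_Phi[of 0] q(2) unfolding isCont_def
      by (intro order_tendstoD(1)[where y = "Phi 0"]) (auto simp: filterlim_at_split)
    then obtain y where y: "y < 0" "\<And>x. y < x \<Longrightarrow> x < 0 \<Longrightarrow> q < Phi x"
      unfolding eventually_at_left_field by blast
    define x where "x = y / 2"
    have x: "x < 0" "q < Phi x" using y(1) y(2)[of x] by (auto simp: x_def)
    have "\<forall>\<^sub>F n in sequentially. ereal (B n 0) < ereal q"
      using q(1) by (rule Limsup_lessD)
    moreover have "\<forall>\<^sub>F n in sequentially. q < B n (m n + x * D n)"
      using B x(2) by (rule order_tendstoD(1))
    ultimately have "\<forall>\<^sub>F n in sequentially. (- x) * D n \<le> m n"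
    proof eventually_elim
      case (elim n)
      show ?case
      proof (rule ccontr)
        assume "\<not> ?thesis"
        then have "B n (m n + x * D n) \<le> B n 0" unfolding B_def by (intro type2_mono) auto
        with elim show False by simp
      qed
    qed
    with x(1) show "\<exists>d>0. \<forall>\<^sub>F n in sequentially. d * D n \<le> m n"
      by (intro exI[of _ "- x"]) auto
  next
    assume "\<exists>d>0. \<forall>\<^sub>F n in sequentially. d * D n \<le> m n"
    then obtain d where d: "d > 0" "\<forall>\<^sub>F n in sequentially. d * D n \<le> m n" by blast
    show "consistent \<sigma> w f"
      unfolding consistent_def
    proof (intro allI impI)
      fix \<alpha> :: real and t :: "nat \<Rightarrow> real"
      assume \<alpha>: "0 < \<alpha> \<and> \<alpha> < 1" and t: "(\<lambda>n. type1 \<sigma> w n (t n) / \<alpha>) \<longlonglongrightarrow> 1"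
      have "(\<lambda>n. 1 - \<alpha> * (type1 \<sigma> w n (t n) / \<alpha>)) \<longlonglongrightarrow> 1 - \<alpha> * 1"
        by (intro tendsto_intros t)
      then have At: "(\<lambda>n. A n (t n)) \<longlonglongrightarrow> 1 - \<alpha>"
        using \<alpha> by (simp add: type1_eq A_def)
      obtain z where z: "Phi z = 1 - \<alpha>" by (rule Phi_surj[of "1 - \<alpha>"]) (use \<alpha> in auto)
      \<comment> \<open>The margin d is spent in halves. A value p strictly between Phi z and Phi (z
        + d/2) forces \<open>t n\<close> below (z + d/2) times the scale; subtracting the shift,
        which is at least d times the scale, leaves z - d/2, and Phi (z - d/2) < 1 -
        \<alpha>.\<close>
      obtain p where p: "1 - \<alpha> < p" "p < Phi (z + d/2)"
        using dense[OF Phi_strict_mono[of z "z + d/2"]] d(1) z by auto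
      have "\<forall>\<^sub>F n in sequentially. A n (t n) < p" using At p(1) by (rule order_tendstoD(2))
      moreover have "\<forall>\<^sub>F n in sequentially. p < A n ((z + d/2) * D n)"
        using A p(2) by (rule order_tendstoD(1))
      ultimately have le: "\<forall>\<^sub>F n in sequentially. ereal (B n (t n)) \<le> ereal (B n (m n + (z - d/2) * D n))"
        using d(2)
      proof eventually_elim
        case (elim n)
        have "t n < (z + d/2) * D n"
        proof (rule ccontr)
          assume "\<not> ?thesis"
          then have "A n ((z + d/2) * D n) \<le> A n (t n)" unfolding A_def by (intro type2_mono) auto
          with elim show False by simp
        qed
        also have "\<dots> \<le> m n + (z - d/2) * D n" using elim(3) by (simp add: algebra_simps)
        finally show ?case unfolding B_def by (simp add: type2_mono)
      qed
      have "limsup (\<lambda>n. ereal (B n (t n))) \<le> limsup (\<lambda>n. ereal (B n (m n + (z - d/2) * D n)))"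
        by (rule Limsup_mono[OF le])
      also have "\<dots> = ereal (Phi (z - d/2))"
        by (rule lim_imp_Limsup) (auto intro: B)
      also have "\<dots> < ereal (1 - \<alpha>)"
        using Phi_strict_mono[of "z - d/2" z] d(1) z by simp
      finally show "limsup (\<lambda>n. ereal (type2 \<sigma> w n (t n) (f n))) < ereal (1 - \<alpha>)"
        unfolding B_def .
    qed
  qed
  then show ?thesis unfolding D_def m_def .
qed

section \<open>Rates of the weights\<close>

text \<open>The partial sums converge to \<open>rho w n\<close>, which exceeds its own half, so the
  set in the definition of \<open>kn\<close> is finite and the supremum is a maximum. Maximality
  then says that adding the weight at \<open>kn w n\<close> itself passes half of the total.\<close>

lemma kn_crossing:
  assumes w: "\<And>j. 0 \<le> w n j" "summable (\<lambda>j. w n (Suc j))" and \<rho>: "rho w n > 0"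
  shows "kn w n \<ge> 1" "rho w n / 2 < (\<Sum>j\<in>{1..kn w n}. w n j)"
proof -
  let ?S = "{k. (\<Sum>j\<in>{1..<k}. w n j) \<le> rho w n / 2}"
  have "(\<lambda>K. \<Sum>j<K. w n (Suc j)) \<longlonglongrightarrow> rho w n"
    unfolding rho_def using summable_LIMSEQ[OF w(2)] .
  from order_tendstoD(1)[OF this, of "rho w n / 2"] \<rho>
  obtain K where K: "rho w n / 2 < (\<Sum>j<K. w n (Suc j))"
    by (auto simp: eventually_sequentially)
  have "(\<Sum>j<K. w n (Suc j)) = (\<Sum>j\<in>{1..<Suc K}. w n j)"
    by (simp only: atLeastLessThanSuc_atLeastAtMost sum.atLeast1_atMost_eq One_nat_def)
  moreover have "(\<Sum>j\<in>{1..<Suc K}. w n j) \<le> (\<Sum>j\<in>{1..<k}. w n j)" if "k > K" for k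
    using that w(1) by (intro sum_mono2) auto
  ultimately have "?S \<subseteq> {..K}" using K by (fastforce simp: not_le[symmetric])
  then have fin: "finite ?S" using finite_subset by blast
  have 1: "1 \<in> ?S" using \<rho> by simp
  have kn: "kn w n = Max ?S" unfolding kn_def using fin 1 by (intro cSup_eq_Max) blast+
  show "kn w n \<ge> 1" unfolding kn using fin 1 by (rule Max_ge)
  have "Suc (kn w n) \<notin> ?S" using Max_ge[OF fin, of "Suc (kn w n)"] unfolding kn by auto
  then show "rho w n / 2 < (\<Sum>j\<in>{1..kn w n}. w n j)"
    by (simp add: atLeastLessThanSuc_atLeastAtMost)
qed

text \<open>The first \<open>kn w n\<close> weights lie between \<open>kappa2 w n\<close> and
  \<open>w n 1\<close> and carry more than half of the total mass. Counting them, or their squares,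
  gives the first three relations; the last pulls the maximal weight out of the sum of
  squares.\<close>

lemma weight_relations:
  assumes w: "\<And>j. 0 \<le> w n j" "\<And>i j. 1 \<le> i \<Longrightarrow> i \<le> j \<Longrightarrow> w n j \<le> w n i"
    "summable (\<lambda>j. w n (Suc j))" "summable (\<lambda>j. (w n (Suc j))\<^sup>2)" and \<rho>: "rho w n > 0"
  shows "real (kn w n) * kappa2 w n \<le> rho w n"
    and "rho w n \<le> 2 * real (kn w n) * w n 1"
    and "real (kn w n) * (kappa2 w n)\<^sup>2 \<le> (\<Sum>j. (w n (Suc j))\<^sup>2)"
    and "(\<Sum>j. (w n (Suc j))\<^sup>2) \<le> w n 1 * rho w n"
proof -
  let ?K = "kn w n"
  have shift: "(\<Sum>j\<in>{1..?K}. g j) = (\<Sum>j<?K. g (Suc j))" for g :: "nat \<Rightarrow> real"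
    by (simp add: sum.atLeast1_atMost_eq)
  have \<kappa>: "kappa2 w n \<le> w n (Suc j)" if "j < ?K" for j
    unfolding kappa2_def using that by (intro w(2)) auto
  have \<kappa>0: "0 \<le> kappa2 w n" unfolding kappa2_def by (rule w(1))
  have "real ?K * kappa2 w n = (\<Sum>j<?K. kappa2 w n)" by simp
  also have "\<dots> \<le> (\<Sum>j<?K. w n (Suc j))" by (intro sum_mono \<kappa>) auto
  also have "\<dots> \<le> rho w n" unfolding rho_def by (intro sum_le_suminf w) auto
  finally show "real ?K * kappa2 w n \<le> rho w n" .
  have "rho w n / 2 < (\<Sum>j<?K. w n (Suc j))"
    using kn_crossing(2)[where w = w and n = n, OF w(1,3) \<rho>] unfolding shift .
  also have "\<dots> \<le> (\<Sum>j<?K. w n 1)" by (intro sum_mono w) auto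
  finally show "rho w n \<le> 2 * real ?K * w n 1" by simp
  have "real ?K * (kappa2 w n)\<^sup>2 = (\<Sum>j<?K. (kappa2 w n)\<^sup>2)" by simp
  also have "\<dots> \<le> (\<Sum>j<?K. (w n (Suc j))\<^sup>2)" by (intro sum_mono power_mono \<kappa> \<kappa>0) auto
  also have "\<dots> \<le> (\<Sum>j. (w n (Suc j))\<^sup>2)" by (intro sum_le_suminf w) auto
  finally show "real ?K * (kappa2 w n)\<^sup>2 \<le> (\<Sum>j. (w n (Suc j))\<^sup>2)" .
  have "(\<Sum>j. (w n (Suc j))\<^sup>2) \<le> (\<Sum>j. w n 1 * w n (Suc j))"
    using w(1,2) by (intro suminf_le w(4) summable_mult w(3)) (auto simp: power2_eq_square intro!: mult_right_mono)
  also have "\<dots> = w n 1 * rho w n" unfolding rho_def by (rule suminf_mult[OF w(3)])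
  finally show "(\<Sum>j. (w n (Suc j))\<^sup>2) \<le> w n 1 * rho w n" .
qed

text \<open>With the largest weight comparable to \<kappa>^2, the relations say that k \<kappa>^2
  has the order of \<rho>, that is n^(-2r), and k \<kappa>^4 the order n^(-2). Division gives the
  order n^(2r-2) for \<kappa>^2 and n^(2-4r) for k.\<close>

lemma weight_rates:
  fixes \<sigma> r :: real and w :: "nat \<Rightarrow> nat \<Rightarrow> real"
  assumes \<sigma>: "\<sigma> > 0" and w0: "\<forall>n j. w n j \<ge> 0"
    and "A1 w" "A2 \<sigma> w" "A3 r w" "A5 w"
  obtains a1 a2 b1 b2 k1 k2 :: real
  where "a1 > 0" "b1 > 0" "k1 > 0" "a2 > 0" "b2 > 0" "k2 > 0"
    and "\<And>n. n \<ge> 1 \<Longrightarrow> a1 / (real n)\<^sup>2 \<le> (\<Sum>j. (w n (Suc j))\<^sup>2) \<and> (\<Sum>j. (w n (Suc j))\<^sup>2) \<le> a2 / (real n)\<^sup>2"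
    and "\<And>n. n \<ge> 1 \<Longrightarrow> b1 * real n powr (2*r - 2) \<le> kappa2 w n"
    and "\<And>n. n \<ge> 1 \<Longrightarrow> w n 1 \<le> b2 * real n powr (2*r - 2)"
    and "\<And>n. n \<ge> 1 \<Longrightarrow> k1 * real n powr (2 - 4*r) \<le> real (kn w n) \<and> real (kn w n) \<le> k2 * real n powr (2 - 4*r)"
    and "\<And>n. n \<ge> 1 \<Longrightarrow> kn w n \<ge> 1"
    and "\<And>n. n \<ge> 1 \<Longrightarrow> summable (\<lambda>j. (w n (Suc j))\<^sup>2)"
    and "\<And>n. n \<ge> 1 \<Longrightarrow> summable (\<lambda>j. w n (Suc j))"
    and "\<And>n. n \<ge> 1 \<Longrightarrow> 0 < (\<Sum>j. (w n (Suc j))\<^sup>2)"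
proof -
  define W where "W = (\<lambda>n. \<Sum>j. (w n (Suc j))\<^sup>2)"
  from \<open>A2 \<sigma> w\<close> obtain A A' where A: "0 < A"
    "\<And>n. n \<ge> 1 \<Longrightarrow> summable (\<lambda>j. (w n (Suc j))\<^sup>2) \<and> A < (real n)\<^sup>2 / \<sigma>^4 * W n \<and> (real n)\<^sup>2 / \<sigma>^4 * W n < A'"
    unfolding A2_def W_def by blast
  from \<open>A3 r w\<close> obtain c1 c2 where c: "0 < c1"
    "\<And>n. n \<ge> 1 \<Longrightarrow> summable (\<lambda>j. w n (Suc j)) \<and> c1 * real n powr (-2*r) \<le> rho w n \<and> rho w n \<le> c2 * real n powr (-2*r)"
    unfolding A3_def by blast
  from \<open>A5 w\<close> obtain C where C: "\<And>n. n \<ge> 1 \<Longrightarrow> w n 1 \<le> C * kappa2 w n"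
    unfolding A5_def by blast
  define a1 where "a1 = A * \<sigma>^4"
  define a2 where "a2 = A' * \<sigma>^4"
  have a: "a1 / (real n)\<^sup>2 \<le> W n \<and> W n \<le> a2 / (real n)\<^sup>2" if "n \<ge> 1" for n
    using A(2)[OF that] that \<sigma> unfolding a1_def a2_def by (simp add: field_simps)
  have \<rho>: "0 < rho w n" if "n \<ge> 1" for n
  proof -
    have "0 < c1 * real n powr (-2*r)" using c(1) that by simp
    also have "\<dots> \<le> rho w n" using c(2)[OF that] by simp
    finally show ?thesis .
  qed
  have mono: "w n j \<le> w n i" if "n \<ge> 1" "1 \<le> i" "i \<le> j" for n i j
    using \<open>A1 w\<close> that unfolding A1_def by blast
  note rel = weight_relations[where w = w, OF w0[rule_format] mono]
  have kn1: "kn w n \<ge> 1" if "n \<ge> 1" for n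
    using kn_crossing(1)[where w = w and n = n] w0 c(2) \<rho> that by blast
  have \<kappa>0: "kappa2 w n \<ge> 0" for n unfolding kappa2_def using w0 by blast
  have C\<kappa>: "0 < C * kappa2 w n" if "n \<ge> 1" for n
  proof -
    \<comment> \<open>If the largest weight vanished, the second relation would give
      \<open>rho w n\<close> <= 0. This yields positivity of the constant \<open>C\<close>, about
      which \<open>A5\<close> asserts no sign.\<close>
    have "0 < w n 1"
    proof (rule ccontr)
      assume "\<not> ?thesis"
      then have "w n 1 = 0" using w0[rule_format, of n 1] by linarith
      then show False using rel(2)[OF that] c(2)[OF that] A(2)[OF that] \<rho>[OF that] by auto
    qed
    then show ?thesis using C[OF that] by simp
  qed
  have C0: "C > 0" using C\<kappa>[of 1] \<kappa>0[of 1] by (simp add: zero_less_mult_iff)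
  have \<kappa>p: "kappa2 w n > 0" if "n \<ge> 1" for n
    using C\<kappa>[OF that] C0 by (simp add: zero_less_mult_iff)
  have c2: "c2 > 0"
  proof -
    have "0 < c2 * real 1 powr (-2*r)" using \<rho>[of 1] c(2)[of 1] by simp
    then show ?thesis by simp
  qed
  have a1p: "a1 > 0" unfolding a1_def using A(1) \<sigma> by simp
  have a2p: "a2 > 0" using a[of 1] a1p by simp
  \<comment> \<open>\<open>b1\<close> comes from W <= C \<kappa> \<rho> and \<open>b0\<close> from
    \<kappa> \<rho> <= 2 C k \<kappa>^2 <= 2 C W, where \<kappa> stands for
    \<open>kappa2 w n\<close>; in both, the common factor n^(-2r) is cancelled.\<close>
  define b1 where "b1 = a1 / (C * c2)"
  define b0 where "b0 = 2 * C * a2 / c1"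
  have b1: "b1 > 0" and b0: "b0 > 0" unfolding b1_def b0_def using a1p a2p C0 c2 c(1) by auto
  have xy: "real n powr (-2*r) * real n powr (2*r - 2) = 1 / (real n)\<^sup>2" if "n \<ge> 1" for n
    using that by (simp add: powr_add[symmetric] powr_minus_divide[of _ 2, simplified])
  have xdy: "real n powr (-2*r) / real n powr (2*r - 2) = real n powr (2 - 4*r)" if "n \<ge> 1" for n
    using that by (simp add: powr_diff[symmetric])
  have up: "kappa2 w n \<le> b0 * real n powr (2*r - 2)"
    and low: "b1 * real n powr (2*r - 2) \<le> kappa2 w n"
    and kn_up: "real (kn w n) \<le> c2 / b1 * real n powr (2 - 4*r)"
    and kn_low: "c1 / (2 * C * b0) * real n powr (2 - 4*r) \<le> real (kn w n)"
    if n: "n \<ge> 1" for n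
  proof -
    define x y k \<kappa> \<rho>' where defs: "x = real n powr (-2*r)" "y = real n powr (2*r - 2)" "k = real (kn w n)"
      "\<kappa> = kappa2 w n" "\<rho>' = rho w n"
    have x: "x > 0" "y > 0" "x * y = 1 / (real n)\<^sup>2" unfolding defs using n xy[OF n] by auto
    have k: "k > 0" unfolding defs using kn1[OF n] by simp
    have \<kappa>: "\<kappa> > 0" unfolding defs using \<kappa>p[OF n] .
    have \<rho>b: "c1 * x \<le> \<rho>'" "\<rho>' \<le> c2 * x" "\<rho>' > 0" unfolding defs using c(2)[OF n] \<rho>[OF n] by auto
    have r1: "k * \<kappa> \<le> \<rho>'" and r2: "\<rho>' \<le> 2 * k * (C * \<kappa>)" and r3: "k * \<kappa>\<^sup>2 \<le> W n" and r4: "W n \<le> C * \<kappa> * \<rho>'"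
    proof -
      show "k * \<kappa> \<le> \<rho>'" unfolding defs using rel(1)[of n] n A(2)[OF n] c(2)[OF n] \<rho>[OF n] by auto
      have "\<rho>' \<le> 2 * k * w n 1" unfolding defs using rel(2)[of n] n A(2)[OF n] c(2)[OF n] \<rho>[OF n] by auto
      also have "\<dots> \<le> 2 * k * (C * \<kappa>)" unfolding defs using C[OF n] by (intro mult_left_mono) auto
      finally show "\<rho>' \<le> 2 * k * (C * \<kappa>)" .
      show "k * \<kappa>\<^sup>2 \<le> W n" unfolding defs W_def using rel(3)[of n] n A(2)[OF n] c(2)[OF n] \<rho>[OF n] by auto
      have "W n \<le> w n 1 * \<rho>'" unfolding defs W_def using rel(4)[of n] n A(2)[OF n] c(2)[OF n] \<rho>[OF n] by auto
      also have "\<dots> \<le> C * \<kappa> * \<rho>'" using C[OF n] \<rho>b(3) unfolding defs by (intro mult_right_mono) auto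
      finally show "W n \<le> C * \<kappa> * \<rho>'" .
    qed
    have "\<kappa> * (c1 * x) \<le> \<kappa> * \<rho>'" using \<rho>b \<kappa> by (intro mult_left_mono) auto
    also have "\<dots> \<le> \<kappa> * (2 * k * (C * \<kappa>))" using r2 \<kappa> by (intro mult_left_mono) auto
    also have "\<dots> = 2 * C * (k * \<kappa>\<^sup>2)" by (simp add: power2_eq_square)
    also have "\<dots> \<le> 2 * C * W n" using r3 C0 by (intro mult_left_mono) auto
    also have "\<dots> \<le> 2 * C * (a2 * (x * y))" using a[OF n] C0 x(3) by (intro mult_left_mono) auto
    finally have "(\<kappa> * c1) * x \<le> (2 * C * a2 * y) * x" by (simp add: mult_ac)
    then have "\<kappa> * c1 \<le> 2 * C * a2 * y" using x(1) by simp
    then have up: "\<kappa> \<le> b0 * y" unfolding b0_def using c(1) by (simp add: field_simps)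
    have "a1 * (x * y) \<le> W n" using a[OF n] x(3) by simp
    also have "\<dots> \<le> C * \<kappa> * \<rho>'" by (rule r4)
    also have "\<dots> \<le> C * \<kappa> * (c2 * x)" using \<rho>b C0 \<kappa> by (intro mult_left_mono) auto
    finally have "(a1 * y) * x \<le> (C * c2 * \<kappa>) * x" by (simp add: mult_ac)
    then have "a1 * y \<le> C * c2 * \<kappa>" using x(1) by simp
    then have low: "b1 * y \<le> \<kappa>" unfolding b1_def using C0 c2 by (simp add: field_simps)
    show "kappa2 w n \<le> b0 * real n powr (2*r - 2)" "b1 * real n powr (2*r - 2) \<le> kappa2 w n"
      using up low unfolding defs by auto
    have "k * (b1 * y) \<le> k * \<kappa>" using low k by (intro mult_left_mono) auto
    also have "\<dots> \<le> c2 * x" using r1 \<rho>b by simp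
    finally have "k \<le> c2 / b1 * (x / y)" using b1 x by (simp add: field_simps)
    then show "real (kn w n) \<le> c2 / b1 * real n powr (2 - 4*r)"
      unfolding xdy[OF n, symmetric] defs .
    have "c1 * x \<le> 2 * k * (C * \<kappa>)" using r2 \<rho>b by simp
    also have "\<dots> \<le> 2 * k * (C * (b0 * y))" using up C0 k by (intro mult_left_mono) auto
    finally have "c1 / (2 * C * b0) * (x / y) \<le> k" using C0 b0 x by (simp add: field_simps)
    then show "c1 / (2 * C * b0) * real n powr (2 - 4*r) \<le> real (kn w n)"
      unfolding xdy[OF n, symmetric] defs .
  qed
  show thesis
  proof (rule that[of a1 b1 "c1 / (2 * C * b0)" a2 "C * b0" "c2 / b1"], goal_cases)
    case (9 n)
    have "w n 1 \<le> C * kappa2 w n" by (rule C[OF 9])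
    also have "\<dots> \<le> C * (b0 * real n powr (2*r - 2))" using up[OF 9] C0 by (intro mult_left_mono) auto
    finally show ?case by simp
  next
    case (14 n)
    have "0 < a1 / (real n)\<^sup>2" using a1p 14 by simp
    then show ?case using a[OF 14] unfolding W_def by linarith
  qed (use a1p a2p b1 b0 C0 c2 c A a low kn_up kn_low kn1 in \<open>auto simp: W_def\<close>)
qed

section \<open>Truncated signals and Besov balls\<close>

definition truncate_seq :: "nat \<Rightarrow> (nat \<Rightarrow> real) \<Rightarrow> nat \<Rightarrow> real" where
  "truncate_seq L \<theta> = (\<lambda>j. if j \<le> L then \<theta> j else 0)"

lemma l2sq_nonneg: "in_L2 \<theta> \<Longrightarrow> 0 \<le> l2sq \<theta>"
  unfolding l2sq_def in_L2_def by (intro suminf_nonneg) auto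

lemma l2norm_power2: "in_L2 \<theta> \<Longrightarrow> (l2norm \<theta>)\<^sup>2 = l2sq \<theta>"
  unfolding l2norm_def using l2sq_nonneg by simp

lemma in_L2_truncate: "in_L2 (truncate_seq L \<theta>)"
  unfolding in_L2_def
  by (rule summable_finite[of "{..<L}"]) (auto simp: truncate_seq_def)

lemma in_L2_diff:
  assumes "in_L2 \<theta>" "in_L2 \<eta>" shows "in_L2 (\<lambda>j. \<theta> j - \<eta> j)"
  unfolding in_L2_def
proof (rule summable_comparison_test')
  show "summable (\<lambda>j. 2 * (\<theta> (Suc j))\<^sup>2 + 2 * (\<eta> (Suc j))\<^sup>2)"
    using assms unfolding in_L2_def by (intro summable_add summable_mult)
  have "(\<theta> (Suc j) - \<eta> (Suc j))\<^sup>2 \<le> 2 * (\<theta> (Suc j))\<^sup>2 + 2 * (\<eta> (Suc j))\<^sup>2" for j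
    using zero_le_power2[of "\<theta> (Suc j) + \<eta> (Suc j)"] by (simp add: power2_eq_square algebra_simps)
  then show "norm ((\<theta> (Suc j) - \<eta> (Suc j))\<^sup>2) \<le> 2 * (\<theta> (Suc j))\<^sup>2 + 2 * (\<eta> (Suc j))\<^sup>2" for j
    by simp
qed

lemma l2sq_truncate_split:
  assumes "in_L2 \<theta>"
  shows "l2sq \<theta> = l2sq (truncate_seq L \<theta>) + l2sq (\<lambda>j. \<theta> j - truncate_seq L \<theta> j)"
proof -
  have "l2sq (truncate_seq L \<theta>) + l2sq (\<lambda>j. \<theta> j - truncate_seq L \<theta> j)
    = (\<Sum>j. (truncate_seq L \<theta> (Suc j))\<^sup>2 + (\<theta> (Suc j) - truncate_seq L \<theta> (Suc j))\<^sup>2)"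
    unfolding l2sq_def
    using in_L2_truncate[of L \<theta>] in_L2_diff[OF assms in_L2_truncate[of L \<theta>]]
    by (intro suminf_add) (auto simp: in_L2_def)
  also have "\<dots> = l2sq \<theta>"
    unfolding l2sq_def by (intro suminf_cong) (auto simp: truncate_seq_def)
  finally show ?thesis by simp
qed

lemma l2sq_truncate_le: "in_L2 \<theta> \<Longrightarrow> l2sq (truncate_seq L \<theta>) \<le> l2sq \<theta>"
  using l2sq_truncate_split[of \<theta> L] l2sq_nonneg[OF in_L2_diff[OF _ in_L2_truncate[of L \<theta>]]] by force

lemma l2sq_truncate_tendsto:
  assumes "in_L2 \<theta>"
  shows "(\<lambda>L. l2sq (truncate_seq L \<theta>)) \<longlonglongrightarrow> l2sq \<theta>"
proof -
  have "l2sq (truncate_seq L \<theta>) = (\<Sum>j<L. (\<theta> (Suc j))\<^sup>2)" for L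
    unfolding l2sq_def
    by (subst suminf_finite[of "{..<L}"]) (auto simp: truncate_seq_def intro!: sum.cong)
  then show ?thesis
    using summable_LIMSEQ[of "\<lambda>j. (\<theta> (Suc j))\<^sup>2"] assms unfolding l2sq_def[of \<theta>] in_L2_def by simp
qed

text \<open>Beyond L the truncated sequence has no tail; for smaller \<open>lam\<close> the tail is
  at most the full energy and \<open>lam powr (2 * s)\<close> is at most its value at L. The Besov
  condition thus reduces to one inequality at L.\<close>

lemma truncate_in_besov_ball:
  assumes \<theta>: "in_L2 \<theta>" and s: "0 \<le> s" and P: "real L powr (2 * s) * l2sq \<theta> \<le> P" "0 \<le> P"
  shows "truncate_seq L \<theta> \<in> besov_ball s P"
  unfolding besov_ball_def
proof (safe intro!: in_L2_truncate)
  fix lam :: real assume lam: "lam > 0"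
  let ?g = "\<lambda>j. if real (Suc j) > lam then (truncate_seq L \<theta> (Suc j))\<^sup>2 else 0"
  show "lam powr (2 * s) * suminf ?g \<le> P"
  proof (cases "lam < real L")
    case True
    have sg: "summable ?g" by (rule summable_finite[of "{..<L}"]) (auto simp: truncate_seq_def)
    then have "suminf ?g \<le> l2sq \<theta>"
      unfolding l2sq_def
      by (intro suminf_le) (use \<theta> in \<open>auto simp: truncate_seq_def in_L2_def\<close>)
    moreover have "lam powr (2 * s) \<le> real L powr (2 * s)"
      using lam True s by (intro powr_mono2) auto
    ultimately have "lam powr (2 * s) * suminf ?g \<le> real L powr (2 * s) * l2sq \<theta>"
      using l2sq_nonneg[OF \<theta>]
      by (intro mult_mono suminf_nonneg sg) auto
    then show ?thesis using P by linarith
  next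
    case False
    then have "?g = (\<lambda>_. 0)" by (auto simp: truncate_seq_def)
    then show ?thesis using P by simp
  qed
qed

text \<open>Decreasing weights are at most \<open>w n 1\<close> up to L and at most
  \<open>w n L\<close> beyond. If the last weight is small, a large shift can only come from energy
  in the first L coefficients.\<close>

lemma signal_shift_le_truncate:
  assumes \<theta>: "in_L2 \<theta>" and L: "1 \<le> L"
    and w: "\<And>j. 0 \<le> w n j" "\<And>i j. 1 \<le> i \<Longrightarrow> i \<le> j \<Longrightarrow> w n j \<le> w n i"
  shows "signal_shift w n \<theta> \<le> w n 1 * l2sq (truncate_seq L \<theta>) + w n L * l2sq \<theta>"
proof -
  have s1: "summable (\<lambda>j. w n (Suc j) * (\<theta> (Suc j))\<^sup>2)"
    by (rule summable_weighted_squares[where B = "w n 1"]) (use \<theta> w in \<open>auto simp: in_L2_def\<close>)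
  have s2: "summable (\<lambda>j. w n 1 * (truncate_seq L \<theta> (Suc j))\<^sup>2)" "summable (\<lambda>j. w n L * (\<theta> (Suc j))\<^sup>2)"
    using in_L2_truncate[of L \<theta>] \<theta> unfolding in_L2_def by (auto intro: summable_mult)
  have "signal_shift w n \<theta> \<le> (\<Sum>j. w n 1 * (truncate_seq L \<theta> (Suc j))\<^sup>2 + w n L * (\<theta> (Suc j))\<^sup>2)"
    unfolding signal_shift_def
  proof (intro suminf_le s1 summable_add s2)
    fix j
    show "w n (Suc j) * (\<theta> (Suc j))\<^sup>2 \<le> w n 1 * (truncate_seq L \<theta> (Suc j))\<^sup>2 + w n L * (\<theta> (Suc j))\<^sup>2"
    proof (cases "Suc j \<le> L")
      case True
      have "w n (Suc j) * (\<theta> (Suc j))\<^sup>2 \<le> w n 1 * (\<theta> (Suc j))\<^sup>2" by (intro mult_right_mono w) auto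
      moreover have "0 \<le> w n L * (\<theta> (Suc j))\<^sup>2" using w(1) by simp
      ultimately show ?thesis using True by (simp add: truncate_seq_def)
    next
      case False
      have "w n (Suc j) * (\<theta> (Suc j))\<^sup>2 \<le> w n L * (\<theta> (Suc j))\<^sup>2" using False L by (intro mult_right_mono w) auto
      then show ?thesis using False by (simp add: truncate_seq_def)
    qed
  qed
  also have "\<dots> = w n 1 * l2sq (truncate_seq L \<theta>) + w n L * l2sq \<theta>"
    unfolding l2sq_def using s2 in_L2_truncate[of L \<theta>] \<theta>
    by (simp add: suminf_add[symmetric] suminf_mult in_L2_def)
  finally show ?thesis .
qed

text \<open>Each of the first L weights is at least \<open>w n L\<close>. For L = 0 the left side is
  0, because index 0 does not contribute to \<open>l2sq\<close>.\<close>

lemma signal_shift_ge_truncate: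
  assumes \<theta>: "in_L2 \<theta>" 
    and w: "\<And>j. 0 \<le> w n j" "\<And>i j. 1 \<le> i \<Longrightarrow> i \<le> j \<Longrightarrow> w n j \<le> w n i"
  shows "w n L * l2sq (truncate_seq L \<theta>) \<le> signal_shift w n \<theta>"
proof -
  have s1: "summable (\<lambda>j. w n (Suc j) * (\<theta> (Suc j))\<^sup>2)"
    by (rule summable_weighted_squares[where B = "w n 1"]) (use \<theta> w in \<open>auto simp: in_L2_def\<close>)
  have s2: "summable (\<lambda>j. (truncate_seq L \<theta> (Suc j))\<^sup>2)"
    using in_L2_truncate[of L \<theta>] unfolding in_L2_def .
  have "w n L * l2sq (truncate_seq L \<theta>) = (\<Sum>j. w n L * (truncate_seq L \<theta> (Suc j))\<^sup>2)"
    unfolding l2sq_def by (rule suminf_mult[OF s2, symmetric])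
  also have "\<dots> \<le> signal_shift w n \<theta>"
    unfolding signal_shift_def
    by (intro suminf_le s1 summable_mult s2)
       (use w in \<open>auto simp: truncate_seq_def intro!: mult_right_mono\<close>)
  finally show ?thesis .
qed

text \<open>The energy identity is global and gives no coordinatewise information, so L^2
  orthogonality is exploited by bounding the energy of \<theta> - g from below: by 0 up to L, and by
  AM-GM beyond L, where little of g remains. Comparison with the identity shows that the energy of
  g, up to two small losses, must appear in \<theta> below L.\<close>

lemma truncate_ge_of_orthogonal:
  fixes \<epsilon> :: real and L :: nat and \<theta> g :: "nat \<Rightarrow> real"
  assumes \<theta>: "in_L2 \<theta>" and g: "in_L2 g" and \<epsilon>: "\<epsilon> > 0"
    and orth: "l2sq \<theta> = l2sq g + l2sq (\<lambda>j. \<theta> j - g j)"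
  defines "tail \<equiv> \<Sum>j. if Suc j > L then (g (Suc j))\<^sup>2 else 0"
  shows "l2sq g - \<epsilon> * l2sq \<theta> - tail / \<epsilon> \<le> l2sq (truncate_seq L \<theta>)"
proof -
  have st: "summable (\<lambda>j. if Suc j > L then (g (Suc j))\<^sup>2 else 0)"
    by (rule summable_comparison_test'[where N = 0, OF g[unfolded in_L2_def]]) auto
  have sT: "summable (\<lambda>j. (truncate_seq L \<theta> (Suc j))\<^sup>2)"
    using in_L2_truncate[of L \<theta>] unfolding in_L2_def .
  have s\<theta>: "summable (\<lambda>j. (\<theta> (Suc j))\<^sup>2)" using \<theta> unfolding in_L2_def .
  have sd: "summable (\<lambda>j. (\<theta> (Suc j) - g (Suc j))\<^sup>2)" using in_L2_diff[OF \<theta> g] unfolding in_L2_def .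
  let ?h = "\<lambda>j. (\<theta> (Suc j))\<^sup>2 - (truncate_seq L \<theta> (Suc j))\<^sup>2 - \<epsilon> * (\<theta> (Suc j))\<^sup>2
      - (if Suc j > L then (g (Suc j))\<^sup>2 else 0) / \<epsilon>"
  have h: "?h sums (l2sq \<theta> - l2sq (truncate_seq L \<theta>) - \<epsilon> * l2sq \<theta> - tail / \<epsilon>)"
    unfolding l2sq_def tail_def
    by (intro sums_diff sums_mult sums_divide summable_sums st sT s\<theta>)
  have "l2sq \<theta> - l2sq (truncate_seq L \<theta>) - \<epsilon> * l2sq \<theta> - tail / \<epsilon> \<le> l2sq (\<lambda>j. \<theta> j - g j)"
    unfolding sums_unique[OF h] l2sq_def[of "\<lambda>j. \<theta> j - g j"]
  proof (intro suminf_le sums_summable[OF h] sd)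
    fix j
    show "?h j \<le> (\<theta> (Suc j) - g (Suc j))\<^sup>2"
    proof (cases "Suc j \<le> L")
      case True
      then have "?h j = - (\<epsilon> * (\<theta> (Suc j))\<^sup>2)" by (simp add: truncate_seq_def)
      also have "\<dots> \<le> 0" using \<epsilon> by simp
      also have "\<dots> \<le> (\<theta> (Suc j) - g (Suc j))\<^sup>2" by simp
      finally show ?thesis .
    next
      case False
      \<comment> \<open>AM-GM: \<open>2 \<theta> g \<le> \<epsilon> \<theta>\<^sup>2 + g\<^sup>2 / \<epsilon>\<close>\<close>
      have "0 \<le> (\<epsilon> * \<theta> (Suc j) - g (Suc j))\<^sup>2 / \<epsilon>" using \<epsilon> by simp
      also have "\<dots> = \<epsilon> * (\<theta> (Suc j))\<^sup>2 - 2 * \<theta> (Suc j) * g (Suc j) + (g (Suc j))\<^sup>2 / \<epsilon>"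
        using \<epsilon> by (simp add: field_simps power2_eq_square)
      finally have "2 * \<theta> (Suc j) * g (Suc j) \<le> \<epsilon> * (\<theta> (Suc j))\<^sup>2 + (g (Suc j))\<^sup>2 / \<epsilon>" by simp
      moreover have "(\<theta> (Suc j) - g (Suc j))\<^sup>2 = (\<theta> (Suc j))\<^sup>2 - 2 * \<theta> (Suc j) * g (Suc j) + (g (Suc j))\<^sup>2"
        by (simp add: power2_diff)
      moreover have "0 \<le> (g (Suc j))\<^sup>2" by simp
      moreover have "?h j = (\<theta> (Suc j))\<^sup>2 - \<epsilon> * (\<theta> (Suc j))\<^sup>2 - (g (Suc j))\<^sup>2 / \<epsilon>"
        using False by (simp add: truncate_seq_def)
      ultimately show ?thesis by linarith
    qed
  qed
  then show ?thesis using orth by linarith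
qed

lemma tendsto_const_mult_neg_powr:
  fixes p K :: real
  assumes "p < 0"
  shows "(\<lambda>n. K * real n powr p) \<longlonglongrightarrow> 0"
  using tendsto_mult_right_zero[OF tendsto_neg_powr[OF assms filterlim_real_sequentially]] by blast

text \<open>Supplies a truncation level for the finitely many early indices, at which an eventual
  lower bound on the shift says nothing.\<close>

lemma exists_truncation:
  assumes "in_L2 \<theta>" "0 < l2sq \<theta>"
  obtains L where "l2sq \<theta> / 2 \<le> l2sq (truncate_seq L \<theta>)"
proof -
  have "\<forall>\<^sub>F L in sequentially. l2sq \<theta> / 2 < l2sq (truncate_seq L \<theta>)"
    by (rule order_tendstoD(1)[OF l2sq_truncate_tendsto[OF assms(1)]]) (use assms(2) in simp)
  then obtain L where "l2sq \<theta> / 2 < l2sq (truncate_seq L \<theta>)"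
    unfolding eventually_sequentially by blast
  then show thesis by (intro that[of L]) simp
qed

section \<open>Equivalence of consistency with an orthogonal Besov component\<close>

theorem theorem7:
  fixes \<sigma> r :: real and w :: "nat \<Rightarrow> nat \<Rightarrow> real" and f :: "nat \<Rightarrow> nat \<Rightarrow> real"
    and c C :: real
  assumes "\<sigma> > 0" and "0 < r" and "r < 1/2"
    and "\<forall>n j. w n j \<ge> 0"
    and "A1 w" and "A2 \<sigma> w" and "A3 r w" and "A4 w" and "A5 w"
    and "0 < c" and "c < C"
    and "\<forall>n\<ge>1. in_L2 (f n)"
    and "\<forall>n\<ge>1. c * real n powr (-r) \<le> l2norm (f n) \<and> l2norm (f n) \<le> C * real n powr (-r)"
  shows "consistent \<sigma> w f \<longleftrightarrow>
    (\<exists>P0 c1 C1 f1. P0 > 0 \<and> 0 < c1 \<and> c1 \<le> C1 \<and>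
       (\<forall>n\<ge>1. f1 n \<in> besov_ball (r / (2 - 4*r)) P0 \<and>
          c1 * real n powr (-r) \<le> l2norm (f1 n) \<and> l2norm (f1 n) \<le> C1 * real n powr (-r) \<and>
          (l2norm (f n))\<^sup>2 = (l2norm (f1 n))\<^sup>2 + (l2norm (\<lambda>j. f n j - f1 n j))\<^sup>2))"
proof -
  note \<sigma> = assms(1) and r = assms(2,3) and w0 = assms(4)[rule_format] and cC = assms(10,11)
    and fL2 = assms(12)[rule_format] and fb = assms(13)[rule_format]
  obtain a1 a2 b1 b2 k1 k2 where pos: "a1 > 0" "b1 > 0" "k1 > 0" "a2 > 0" "b2 > 0" "k2 > 0"
    and W: "\<And>n. n \<ge> 1 \<Longrightarrow> a1 / (real n)\<^sup>2 \<le> (\<Sum>j. (w n (Suc j))\<^sup>2) \<and> (\<Sum>j. (w n (Suc j))\<^sup>2) \<le> a2 / (real n)\<^sup>2"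
    and \<kappa>: "\<And>n. n \<ge> 1 \<Longrightarrow> b1 * real n powr (2*r - 2) \<le> kappa2 w n"
    and w1: "\<And>n. n \<ge> 1 \<Longrightarrow> w n 1 \<le> b2 * real n powr (2*r - 2)"
    and kb: "\<And>n. n \<ge> 1 \<Longrightarrow> k1 * real n powr (2 - 4*r) \<le> real (kn w n) \<and> real (kn w n) \<le> k2 * real n powr (2 - 4*r)"
    and kn1: "\<And>n. n \<ge> 1 \<Longrightarrow> kn w n \<ge> 1"
    and sW: "\<And>n. n \<ge> 1 \<Longrightarrow> summable (\<lambda>j. (w n (Suc j))\<^sup>2)"
    and sw: "\<And>n. n \<ge> 1 \<Longrightarrow> summable (\<lambda>j. w n (Suc j))"
    and Wpos: "\<And>n. n \<ge> 1 \<Longrightarrow> 0 < (\<Sum>j. (w n (Suc j))\<^sup>2)"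
    by (rule weight_rates[OF assms(1,4,5,6,7,9)]) blast
  have mono: "w n j \<le> w n i" if "n \<ge> 1" "1 \<le> i" "i \<le> j" for n i j
    using assms(5) that unfolding A1_def by blast
  have xy: "real n powr (2*r - 2) * real n powr (-2*r) = 1 / (real n)\<^sup>2" if "n \<ge> 1" for n
    using that by (simp add: powr_add[symmetric] powr_minus_divide[of _ 2, simplified])
  have xx: "(real n powr (-r))\<^sup>2 = real n powr (-2*r)" if "n \<ge> 1" for n
    using that by (simp add: powr_power mult.commute)
  have f_up: "l2sq (f n) \<le> C\<^sup>2 * real n powr (-2*r)" and f_low: "c\<^sup>2 * real n powr (-2*r) \<le> l2sq (f n)"
    if n: "n \<ge> 1" for n
  proof -
    have "0 \<le> c * real n powr (-r)" using cC by simp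
    then have "(c * real n powr (-r))\<^sup>2 \<le> (l2norm (f n))\<^sup>2" "(l2norm (f n))\<^sup>2 \<le> (C * real n powr (-r))\<^sup>2"
      using fb[OF n] by (auto intro!: power_mono)
    then show "l2sq (f n) \<le> C\<^sup>2 * real n powr (-2*r)" "c\<^sup>2 * real n powr (-2*r) \<le> l2sq (f n)"
      unfolding l2norm_power2[OF fL2[OF n]] power_mult_distrib xx[OF n] by auto
  qed
  \<comment> \<open>This smoothness makes the power 2s of k_n have order n^(2r), exactly the inverse
    of the energy order n^(-2r). A signal cut at a multiple of k_n therefore sits in a fixed Besov
    ball.\<close>
  define s where "s = r / (2 - 4*r)"
  have s: "s > 0" unfolding s_def using r by simp
  have s_eq: "(2 - 4*r) * (2 * s) = 2*r" unfolding s_def using r by (simp add: field_simps)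
  have kpow: "(real n powr (2 - 4*r)) powr (2 * s) = real n powr (2*r)" for n
    by (simp add: powr_powr s_eq)
  have xinv: "real n powr (2*r) * real n powr (-2*r) = 1" if "n \<ge> 1" for n
    using that by (simp add: powr_add[symmetric])

  have lim1: "(\<lambda>n. w n 1 / sqrt (\<Sum>j. (w n (Suc j))\<^sup>2)) \<longlonglongrightarrow> 0"
  proof (rule Lim_null_comparison[OF eventually_sequentiallyI[of 1]])
    show "(\<lambda>n. b2 / sqrt a1 * real n powr (2*r - 1)) \<longlonglongrightarrow> 0"
      using r by (intro tendsto_const_mult_neg_powr) simp
    fix n :: nat assume n: "1 \<le> n"
    have "sqrt a1 / real n = sqrt (a1 / (real n)\<^sup>2)" by (simp add: real_sqrt_divide)
    also have "\<dots> \<le> sqrt (\<Sum>j. (w n (Suc j))\<^sup>2)" using W[OF n] by simp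
    finally have "w n 1 / sqrt (\<Sum>j. (w n (Suc j))\<^sup>2) \<le> (b2 * real n powr (2*r - 2)) / (sqrt a1 / real n)"
      using w1[OF n] w0 pos n by (intro frac_le) auto
    also have "\<dots> = b2 / sqrt a1 * (real n powr (2*r - 2) * real n powr 1)" using n by simp
    also have "real n powr (2*r - 2) * real n powr 1 = real n powr (2*r - 1)"
      by (simp only: powr_add[symmetric]) simp
    finally show "norm (w n 1 / sqrt (\<Sum>j. (w n (Suc j))\<^sup>2)) \<le> b2 / sqrt a1 * real n powr (2*r - 1)"
      using w0[of n 1] Wpos[OF n] by simp
  qed
  \<comment> \<open>Exponents: 2(2r - 2) from the weight, -2r from the energy, 1 from n and 2 from
    dividing by the sum of squares add up to 2r - 1 < 0, the same rate as in
    \<open>lim1\<close>.\<close>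
  have lim2: "(\<lambda>n. (w n 1)\<^sup>2 * l2sq (f n) * real n / (\<Sum>j. (w n (Suc j))\<^sup>2)) \<longlonglongrightarrow> 0"
  proof (rule Lim_null_comparison[OF eventually_sequentiallyI[of 1]])
    show "(\<lambda>n. b2\<^sup>2 * C\<^sup>2 / a1 * real n powr (2*r - 1)) \<longlonglongrightarrow> 0"
      using r by (intro tendsto_const_mult_neg_powr) simp
    fix n :: nat assume n: "1 \<le> n"
    have l0: "0 \<le> l2sq (f n)" by (rule l2sq_nonneg[OF fL2[OF n]])
    have "(w n 1)\<^sup>2 * l2sq (f n) * real n / (\<Sum>j. (w n (Suc j))\<^sup>2)
      \<le> (b2 * real n powr (2*r - 2))\<^sup>2 * (C\<^sup>2 * real n powr (-2*r)) * real n / (a1 / (real n)\<^sup>2)"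
      using w1[OF n] w0 W[OF n] f_up[OF n] l0 pos n
      by (intro frac_le mult_mono power_mono) auto
    also have "\<dots> = b2\<^sup>2 * C\<^sup>2 / a1 * (real n * real n powr (2*r - 2) * ((real n powr (2*r - 2) * real n powr (-2*r)) * (real n)\<^sup>2))"
      using pos by (simp add: field_simps power2_eq_square)
    also have "(real n powr (2*r - 2) * real n powr (-2*r)) * (real n)\<^sup>2 = 1"
      unfolding xy[OF n] using n by simp
    also have "real n * real n powr (2*r - 2) = real n powr 1 * real n powr (2*r - 2)" using n by simp
    also have "\<dots> = real n powr (2*r - 1)"
      by (simp only: powr_add[symmetric]) simp
    finally show "norm ((w n 1)\<^sup>2 * l2sq (f n) * real n / (\<Sum>j. (w n (Suc j))\<^sup>2)) \<le> b2\<^sup>2 * C\<^sup>2 / a1 * real n powr (2*r - 1)"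
      using l0 Wpos[OF n] by (simp add: abs_mult)
  qed
  have equiv: "consistent \<sigma> w f \<longleftrightarrow>
    (\<exists>d>0. \<forall>\<^sub>F n in sequentially. d * null_scale \<sigma> w n \<le> signal_shift w n (f n))"
    by (rule consistent_iff_shift[OF \<sigma> w0 _ sw sW Wpos fL2 lim1 lim2]) (auto intro: mono)
  have scale_low: "\<sigma>\<^sup>2 * sqrt (2 * a1) / (real n)\<^sup>2 \<le> null_scale \<sigma> w n"
    and scale_up: "null_scale \<sigma> w n \<le> \<sigma>\<^sup>2 * sqrt (2 * a2) / (real n)\<^sup>2" if n: "n \<ge> 1" for n
  proof -
    have e: "\<sigma>\<^sup>2 * sqrt (2 * a) / (real n)\<^sup>2 = \<sigma>\<^sup>2 / real n * sqrt (2 * (a / (real n)\<^sup>2))" for a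
      by (simp add: real_sqrt_divide real_sqrt_mult power2_eq_square)
    show "\<sigma>\<^sup>2 * sqrt (2 * a1) / (real n)\<^sup>2 \<le> null_scale \<sigma> w n"
      "null_scale \<sigma> w n \<le> \<sigma>\<^sup>2 * sqrt (2 * a2) / (real n)\<^sup>2"
      unfolding e null_scale_def using W[OF n]
      by (intro mult_left_mono real_sqrt_le_mono; simp)+
  qed
  \<comment> \<open>The null scale is of exact order n^(-2), so it is replaced by that power at the
    price of changing d.\<close>
  have equiv': "consistent \<sigma> w f \<longleftrightarrow>
    (\<exists>d>0. \<forall>\<^sub>F n in sequentially. d / (real n)\<^sup>2 \<le> signal_shift w n (f n))"
    unfolding equiv
  proof safe
    fix d :: real assume d: "d > 0" "\<forall>\<^sub>F n in sequentially. d * null_scale \<sigma> w n \<le> signal_shift w n (f n)"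
    from d(2) eventually_ge_at_top[of 1]
    have "\<forall>\<^sub>F n in sequentially. d * (\<sigma>\<^sup>2 * sqrt (2 * a1)) / (real n)\<^sup>2 \<le> signal_shift w n (f n)"
    proof eventually_elim
      case (elim n)
      from mult_left_mono[OF scale_low[OF elim(2)], of d] elim(1) d(1) show ?case by simp
    qed
    then show "\<exists>d>0. \<forall>\<^sub>F n in sequentially. d / (real n)\<^sup>2 \<le> signal_shift w n (f n)"
      using d(1) \<sigma> pos by (intro exI[of _ "d * (\<sigma>\<^sup>2 * sqrt (2 * a1))"]) auto
  next
    fix d :: real assume d: "d > 0" "\<forall>\<^sub>F n in sequentially. d / (real n)\<^sup>2 \<le> signal_shift w n (f n)"
    define S where "S = \<sigma>\<^sup>2 * sqrt (2 * a2)"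
    have S: "S > 0" unfolding S_def using \<sigma> pos by simp
    from d(2) eventually_ge_at_top[of 1]
    have "\<forall>\<^sub>F n in sequentially. d / S * null_scale \<sigma> w n \<le> signal_shift w n (f n)"
    proof eventually_elim
      case (elim n)
      have "d / S * null_scale \<sigma> w n \<le> d / S * (S / (real n)\<^sup>2)"
        using scale_up[OF elim(2)] d(1) S unfolding S_def by (intro mult_left_mono) auto
      also have "\<dots> = d / (real n)\<^sup>2" using S by simp
      finally show ?case using elim(1) by simp
    qed
    then show "\<exists>d>0. \<forall>\<^sub>F n in sequentially. d * null_scale \<sigma> w n \<le> signal_shift w n (f n)"
      using d(1) S by (intro exI[of _ "d / S"]) auto
  qed
  show ?thesis
    unfolding equiv' s_def[symmetric]
  proof
    assume "\<exists>d>0. \<forall>\<^sub>F n in sequentially. d / (real n)\<^sup>2 \<le> signal_shift w n (f n)"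
    then obtain d N where d: "d > 0" and N: "\<And>n. n \<ge> N \<Longrightarrow> d / (real n)\<^sup>2 \<le> signal_shift w n (f n)"
      unfolding eventually_sequentially by blast
    from assms(8) obtain C4 lam where C4: "C4 > 0" "lam > 1"
      "\<And>\<delta> n. \<delta> > 0 \<Longrightarrow> n \<ge> 1 \<Longrightarrow> w n (nat \<lfloor>(1+\<delta>) * real (kn w n)\<rfloor>) < C4 * (1+\<delta>) powr (-lam) * kappa2 w n"
      unfolding A4_def by blast
    \<comment> \<open>As \<open>lam\<close> > 1, the decay factor of \<open>A4\<close> is at most 1
      / \<open>\<delta>\<close>. This choice makes the contribution of the weight at the cut at most
      half of the guaranteed shift d / n^2.\<close>
    define \<delta> where "\<delta> = 2 * C4 * b2 * C\<^sup>2 / d"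
    have \<delta>: "\<delta> > 0" unfolding \<delta>_def using C4 pos cC d by simp
    \<comment> \<open>The first entry serves the indices from \<open>N\<close> on, the second the
      earlier ones, where half of the energy is kept.\<close>
    define e where "e = min (d / (2 * b2)) (c\<^sup>2 / 2)"
    have e: "e > 0" unfolding e_def using d pos cC by simp
    define L where "L = (\<lambda>n. if n \<ge> N then nat \<lfloor>(1+\<delta>) * real (kn w n)\<rfloor>
       else (SOME L. l2sq (f n) / 2 \<le> l2sq (truncate_seq L (f n))))"
    have low: "e * real n powr (-2*r) \<le> l2sq (truncate_seq (L n) (f n))" if n: "n \<ge> 1" for n
    proof (cases "n \<ge> N")
      case True
      then have L: "L n = nat \<lfloor>(1+\<delta>) * real (kn w n)\<rfloor>" unfolding L_def by simp
      \<comment> \<open>A cut at 0 has to be excluded, since monotonicity of the weights starts at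
        index 1.\<close>
      have "1 * 1 \<le> (1+\<delta>) * real (kn w n)" using \<delta> kn1[OF n] by (intro mult_mono) auto
      then have L1: "1 \<le> L n" unfolding L by (simp add: le_nat_iff le_floor_iff)
      define y where "y = real n powr (2*r - 2)"
      have y: "y > 0" unfolding y_def using n by simp
      have kw: "kappa2 w n \<le> b2 * y"
        using mono[OF n order_refl kn1[OF n]] w1[OF n] unfolding kappa2_def y_def by simp
      have "(1+\<delta>) powr (-lam) \<le> (1+\<delta>) powr (-1)" using \<delta> C4 by (intro powr_mono) auto
      also have "\<dots> \<le> 1 / \<delta>" using \<delta> by (simp add: powr_minus_divide frac_le)
      finally have "C4 * (1+\<delta>) powr (-lam) * kappa2 w n \<le> C4 * (1 / \<delta>) * (b2 * y)"
        using C4 kw w0 \<delta> unfolding kappa2_def by (intro mult_mono) auto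
      then have wL: "w n (L n) \<le> C4 * (1 / \<delta>) * (b2 * y)"
        using C4(3)[OF \<delta> n] unfolding L by linarith
      have l0: "0 \<le> l2sq (f n)" by (rule l2sq_nonneg[OF fL2[OF n]])
      have t0: "0 \<le> l2sq (truncate_seq (L n) (f n))" by (rule l2sq_nonneg[OF in_L2_truncate])
      have yx: "y * real n powr (-2*r) = 1 / (real n)\<^sup>2" unfolding y_def by (rule xy[OF n])
      have "w n (L n) * l2sq (f n) \<le> C4 * (1 / \<delta>) * (b2 * y) * (C\<^sup>2 * real n powr (-2*r))"
        using wL f_up[OF n] l0 C4 \<delta> pos y by (intro mult_mono) auto
      also have "\<dots> = d / 2 * (y * real n powr (-2*r))"
        unfolding \<delta>_def using C4 pos cC d by (simp add: field_simps)
      finally have t: "w n (L n) * l2sq (f n) \<le> d / 2 * (y * real n powr (-2*r))" .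
      have "d * (y * real n powr (-2*r)) \<le> signal_shift w n (f n)"
        using N[OF True] unfolding yx by simp
      also have "\<dots> \<le> w n 1 * l2sq (truncate_seq (L n) (f n)) + w n (L n) * l2sq (f n)"
        by (rule signal_shift_le_truncate[where w = w and n = n, OF fL2[OF n] L1 w0 mono[OF n]])
      finally have "d / 2 * (y * real n powr (-2*r)) \<le> w n 1 * l2sq (truncate_seq (L n) (f n))"
        using t by simp
      also have "\<dots> \<le> b2 * y * l2sq (truncate_seq (L n) (f n))"
        using w1[OF n] t0 unfolding y_def by (intro mult_right_mono) auto
      finally have "y * (d / 2 * real n powr (-2*r)) \<le> y * (b2 * l2sq (truncate_seq (L n) (f n)))"
        by (simp add: mult_ac)
      then have "d / 2 * real n powr (-2*r) \<le> b2 * l2sq (truncate_seq (L n) (f n))" using y by simp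
      then have "d / (2 * b2) * real n powr (-2*r) \<le> l2sq (truncate_seq (L n) (f n))"
        using pos by (simp add: field_simps)
      moreover have "e * real n powr (-2*r) \<le> d / (2 * b2) * real n powr (-2*r)"
        unfolding e_def by (intro mult_right_mono) auto
      ultimately show ?thesis by linarith
    next
      case False
      have "0 < c\<^sup>2 * real n powr (-2*r)" using cC n by simp
      then have "0 < l2sq (f n)" using f_low[OF n] by linarith
      then have "\<exists>L. l2sq (f n) / 2 \<le> l2sq (truncate_seq L (f n))"
        using exists_truncation[OF fL2[OF n]] by blast
      from someI_ex[OF this] have "l2sq (f n) / 2 \<le> l2sq (truncate_seq (L n) (f n))"
        unfolding L_def if_not_P[OF False] .
      moreover have "e * real n powr (-2*r) \<le> c\<^sup>2 / 2 * real n powr (-2*r)"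
        unfolding e_def by (intro mult_right_mono) auto
      ultimately show ?thesis using f_low[OF n] by simp
    qed
    \<comment> \<open>\<open>Q\<close> bounds the Besov quantity from \<open>N\<close> on and
      \<open>R\<close> collects its finitely many earlier values; the extra 1 in the radius makes it
      strictly positive.\<close>
    define Q where "Q = ((1+\<delta>) * k2) powr (2 * s) * C\<^sup>2"
    define R where "R = (\<Sum>n\<in>{1..<N}. real (L n) powr (2 * s) * l2sq (f n))"
    have Q0: "Q \<ge> 0" unfolding Q_def by simp
    have R0: "R \<ge> 0" unfolding R_def using l2sq_nonneg fL2 by (intro sum_nonneg) auto
    have besov: "real (L n) powr (2 * s) * l2sq (f n) \<le> 1 + Q + R" if n: "n \<ge> 1" for n
    proof (cases "n \<ge> N")
      case True
      have "real (L n) \<le> (1+\<delta>) * real (kn w n)" unfolding L_def using True \<delta> by simp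
      also have "\<dots> \<le> (1+\<delta>) * (k2 * real n powr (2 - 4*r))" using kb[OF n] \<delta> by (intro mult_left_mono) auto
      finally have "real (L n) powr (2 * s) \<le> ((1+\<delta>) * k2 * real n powr (2 - 4*r)) powr (2 * s)"
        using s by (intro powr_mono2) auto
      also have "\<dots> = ((1+\<delta>) * k2) powr (2 * s) * real n powr (2*r)"
        using \<delta> pos by (simp add: powr_mult kpow[simplified])
      finally have "real (L n) powr (2 * s) * l2sq (f n)
          \<le> ((1+\<delta>) * k2) powr (2 * s) * real n powr (2*r) * (C\<^sup>2 * real n powr (-2*r))"
        using f_up[OF n] l2sq_nonneg[OF fL2[OF n]] by (intro mult_mono) auto
      also have "\<dots> = Q * (real n powr (2*r) * real n powr (-2*r))" unfolding Q_def by (simp add: mult_ac)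
      also have "\<dots> = Q" unfolding xinv[OF n] by simp
      finally show ?thesis using R0 by simp
    next
      case False
      then have "real (L n) powr (2 * s) * l2sq (f n) \<le> R"
        unfolding R_def using n fL2 l2sq_nonneg
        by (intro member_le_sum[where f = "\<lambda>n. real (L n) powr (2 * s) * l2sq (f n)"]) auto
      then show ?thesis using Q0 by simp
    qed
    define f1 where "f1 = (\<lambda>n. truncate_seq (L n) (f n))"
    have f1L2: "in_L2 (f1 n)" for n unfolding f1_def by (rule in_L2_truncate)
    \<comment> \<open>The constant is enlarged from \<open>C\<close> by \<open>sqrt e\<close> so
      that it visibly dominates the lower constant \<open>sqrt e\<close>.\<close>
    have norm_up: "l2norm (f1 n) \<le> (C + sqrt e) * real n powr (-r)" if n: "n \<ge> 1" for n
    proof -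
      have "l2norm (f1 n) \<le> l2norm (f n)"
        unfolding l2norm_def f1_def using l2sq_truncate_le[OF fL2[OF n]] by simp
      also have "\<dots> \<le> C * real n powr (-r)" using fb[OF n] by simp
      also have "\<dots> \<le> (C + sqrt e) * real n powr (-r)" using e by (intro mult_right_mono) auto
      finally show ?thesis .
    qed
    have norm_low: "sqrt e * real n powr (-r) \<le> l2norm (f1 n)" if n: "n \<ge> 1" for n
    proof -
      have "sqrt e * real n powr (-r) = sqrt (e * (real n powr (-r))\<^sup>2)" by (simp add: real_sqrt_mult)
      also have "\<dots> \<le> l2norm (f1 n)"
        unfolding l2norm_def f1_def xx[OF n] using low[OF n] by (rule real_sqrt_le_mono)
      finally show ?thesis .
    qed
    show "\<exists>P0 c1 C1 f1. P0 > 0 \<and> 0 < c1 \<and> c1 \<le> C1 \<and>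
       (\<forall>n\<ge>1. f1 n \<in> besov_ball s P0 \<and>
          c1 * real n powr (-r) \<le> l2norm (f1 n) \<and> l2norm (f1 n) \<le> C1 * real n powr (-r) \<and>
          (l2norm (f n))\<^sup>2 = (l2norm (f1 n))\<^sup>2 + (l2norm (\<lambda>j. f n j - f1 n j))\<^sup>2)"
    proof (rule exI[of _ "1 + Q + R"], rule exI[of _ "sqrt e"], rule exI[of _ "C + sqrt e"], rule exI[of _ f1],
        intro conjI allI impI)
      fix n :: nat assume n: "1 \<le> n"
      show "f1 n \<in> besov_ball s (1 + Q + R)"
        unfolding f1_def using s Q0 R0 by (intro truncate_in_besov_ball fL2 n besov) auto
      show "(l2norm (f n))\<^sup>2 = (l2norm (f1 n))\<^sup>2 + (l2norm (\<lambda>j. f n j - f1 n j))\<^sup>2"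
        unfolding l2norm_power2[OF fL2[OF n]] l2norm_power2[OF f1L2] l2norm_power2[OF in_L2_diff[OF fL2[OF n] f1L2]]
        unfolding f1_def by (rule l2sq_truncate_split[OF fL2[OF n]])
    qed (use Q0 R0 e cC norm_up norm_low in auto)
  next
    assume "\<exists>P0 c1 C1 f1. P0 > 0 \<and> 0 < c1 \<and> c1 \<le> C1 \<and>
       (\<forall>n\<ge>1. f1 n \<in> besov_ball s P0 \<and>
          c1 * real n powr (-r) \<le> l2norm (f1 n) \<and> l2norm (f1 n) \<le> C1 * real n powr (-r) \<and>
          (l2norm (f n))\<^sup>2 = (l2norm (f1 n))\<^sup>2 + (l2norm (\<lambda>j. f n j - f1 n j))\<^sup>2)"
    then obtain P0 c1 f1 where P0: "P0 > 0" and c1: "0 < c1"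
      and bes: "\<And>n. n \<ge> 1 \<Longrightarrow> f1 n \<in> besov_ball s P0"
      and f1n: "\<And>n. n \<ge> 1 \<Longrightarrow> c1 * real n powr (-r) \<le> l2norm (f1 n)"
      and orth: "\<And>n. n \<ge> 1 \<Longrightarrow> (l2norm (f n))\<^sup>2 = (l2norm (f1 n))\<^sup>2 + (l2norm (\<lambda>j. f n j - f1 n j))\<^sup>2"
      by blast
    \<comment> \<open>The component has energy at least c1^2 n^(-2r). Both \<open>\<epsilon>\<close>
      and \<open>q\<close> are tuned so that each of the two losses in
      \<open>truncate_ge_of_orthogonal\<close> is at most a quarter of this, leaving one
      half.\<close>
    define \<epsilon> where "\<epsilon> = c1\<^sup>2 / (4 * C\<^sup>2)"
    have \<epsilon>: "\<epsilon> > 0" unfolding \<epsilon>_def using c1 cC by simp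
    define q where "q = P0 / (\<epsilon> * c1\<^sup>2 / 4)"
    have q: "q > 0" unfolding q_def using P0 \<epsilon> c1 by simp
    \<comment> \<open>The second summand makes the power 2s of cc k1 at least \<open>q\<close>; the
      1 ensures cc > 1, as required by \<open>A5\<close>.\<close>
    define cc where "cc = 1 + q powr (1 / (2 * s)) / k1"
    have cc: "cc > 1" unfolding cc_def using q pos by simp
    have ccq: "q \<le> (cc * k1) powr (2 * s)"
    proof -
      have "q = (q powr (1 / (2 * s))) powr (2 * s)" using q s by (simp add: powr_powr)
      also have "\<dots> \<le> (cc * k1) powr (2 * s)"
        using s pos by (intro powr_mono2) (auto simp: cc_def field_simps)
      finally show ?thesis .
    qed
    from assms(9) cc obtain C5 where C5: "C5 > 0"
      "\<And>n. n \<ge> 1 \<Longrightarrow> w n (nat \<lfloor>cc * real (kn w n)\<rfloor>) \<ge> C5 * kappa2 w n"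
      unfolding A5_def by blast
    have "C5 * b1 * (c1\<^sup>2 / 2) / (real n)\<^sup>2 \<le> signal_shift w n (f n)" if n: "n \<ge> 1" for n
    proof -
      define L where "L = nat \<lfloor>cc * real (kn w n)\<rfloor>"
      define x where "x = real n powr (-2*r)"
      have x: "x > 0" unfolding x_def using n by simp
      have f1L2: "in_L2 (f1 n)" using bes[OF n] unfolding besov_ball_def by simp
      have o: "l2sq (f n) = l2sq (f1 n) + l2sq (\<lambda>j. f n j - f1 n j)"
        using orth[OF n] l2norm_power2[OF fL2[OF n]] l2norm_power2[OF f1L2]
          l2norm_power2[OF in_L2_diff[OF fL2[OF n] f1L2]] by simp
      define tail where "tail = (\<Sum>j. if Suc j > L then (f1 n (Suc j))\<^sup>2 else 0)"
      have tail0: "0 \<le> tail"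
        unfolding tail_def
        by (intro suminf_nonneg summable_comparison_test'[where N = 0, OF f1L2[unfolded in_L2_def]]) auto
      have \<tau>: "0 < cc * real (kn w n)" using cc kn1[OF n] by simp
      \<comment> \<open>An integer exceeds a positive real exactly when it exceeds its floor, so the
        Besov condition at the real level \<open>cc * real (kn w n)\<close> speaks about the tail
        beyond the integer cut \<open>L\<close>.\<close>
      have gt: "real (Suc j) > cc * real (kn w n) \<longleftrightarrow> Suc j > L" for j
        unfolding L_def using \<tau> by linarith
      have "(cc * real (kn w n)) powr (2 * s) * (\<Sum>j. if real (Suc j) > cc * real (kn w n) then (f1 n (Suc j))\<^sup>2 else 0) \<le> P0"
        using bes[OF n] \<tau> unfolding besov_ball_def by blast
      then have tl: "(cc * real (kn w n)) powr (2 * s) * tail \<le> P0" unfolding gt tail_def .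
      have "q * real n powr (2*r) \<le> (cc * k1) powr (2 * s) * real n powr (2*r)"
        using ccq by (intro mult_right_mono) auto
      also have "\<dots> = (cc * k1 * real n powr (2 - 4*r)) powr (2 * s)"
        using cc pos by (simp add: powr_mult kpow[simplified])
      also have "\<dots> \<le> (cc * real (kn w n)) powr (2 * s)"
        using s cc pos kb[OF n] by (intro powr_mono2) auto
      finally have "q * real n powr (2*r) * tail \<le> (cc * real (kn w n)) powr (2 * s) * tail"
        using tail0 by (intro mult_right_mono) auto
      then have "q * real n powr (2*r) * tail \<le> P0" using tl by linarith
      \<comment> \<open>Multiplying by n^(-2r) cancels the power of n on the left and shows that the
        tail has the order of the energy, with a factor made small by \<open>q\<close>.\<close>
      then have "q * real n powr (2*r) * tail * x \<le> P0 * x" using x by (intro mult_right_mono) auto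
      moreover have "q * real n powr (2*r) * tail * x = q * tail * (real n powr (2*r) * real n powr (-2*r))"
        unfolding x_def by (simp add: mult_ac)
      ultimately have "q * tail \<le> P0 * x" unfolding xinv[OF n] by simp
      then have t: "tail / \<epsilon> \<le> c1\<^sup>2 / 4 * x"
        unfolding q_def using P0 \<epsilon> c1 by (simp add: field_simps)
      have "0 \<le> c1 * real n powr (-r)" using c1 by simp
      then have "(c1 * real n powr (-r))\<^sup>2 \<le> (l2norm (f1 n))\<^sup>2" using f1n[OF n] by (intro power_mono)
      then have g: "c1\<^sup>2 * x \<le> l2sq (f1 n)"
        unfolding l2norm_power2[OF f1L2] power_mult_distrib xx[OF n] x_def .
      have "\<epsilon> * l2sq (f n) \<le> \<epsilon> * (C\<^sup>2 * x)" unfolding x_def using f_up[OF n] \<epsilon> by (intro mult_left_mono) auto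
      also have "\<dots> = c1\<^sup>2 / 4 * x" unfolding \<epsilon>_def using cC by simp
      finally have "c1\<^sup>2 / 2 * x \<le> l2sq (f1 n) - \<epsilon> * l2sq (f n) - tail / \<epsilon>" using t g by simp
      also have "\<dots> \<le> l2sq (truncate_seq L (f n))"
        unfolding tail_def by (rule truncate_ge_of_orthogonal[OF fL2[OF n] f1L2 \<epsilon> o])
      finally have tr: "c1\<^sup>2 / 2 * x \<le> l2sq (truncate_seq L (f n))" .
      \<comment> \<open>\<open>A5\<close> keeps the weight at the cut of order n^(2r-2); times the
        low-frequency energy of order n^(-2r) this gives a shift of order n^(-2).\<close>
      have "C5 * (b1 * real n powr (2*r - 2)) \<le> C5 * kappa2 w n" using \<kappa>[OF n] C5 by (intro mult_left_mono) auto
      then have wL: "C5 * (b1 * real n powr (2*r - 2)) \<le> w n L" using C5(2)[OF n] unfolding L_def by linarith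
      have "C5 * b1 * (c1\<^sup>2 / 2) / (real n)\<^sup>2 = C5 * b1 * (c1\<^sup>2 / 2) * (1 / (real n)\<^sup>2)" by simp
      also have "\<dots> = C5 * (b1 * real n powr (2*r - 2)) * (c1\<^sup>2 / 2 * x)"
        unfolding xy[OF n, symmetric] x_def by (simp add: mult_ac)
      also have "\<dots> \<le> w n L * l2sq (truncate_seq L (f n))"
        using wL tr w0 x by (intro mult_mono) auto
      also have "\<dots> \<le> signal_shift w n (f n)"
        by (rule signal_shift_ge_truncate[where w = w and n = n, OF fL2[OF n] w0 mono[OF n]])
      finally show ?thesis .
    qed
    then show "\<exists>d>0. \<forall>\<^sub>F n in sequentially. d / (real n)\<^sup>2 \<le> signal_shift w n (f n)"
      using C5 pos c1 by (intro exI[of _ "C5 * b1 * (c1\<^sup>2 / 2)"]) (auto intro: eventually_sequentiallyI[of 1])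
  qed
qed

end
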